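(* Let $n \geq 2$ and let $K \subset \mathbb{R}^n$ be a convex body. If $2 \leq p < \infty$ and $d(K, B_p^n) \geq (1-\varepsilon)n$ for some $0 \leq \varepsilon \leq \varepsilon_0$, then $$d(K, S_n) \leq 1 + C_0 \varepsilon^{\frac13},$$ where $\varepsilon_0 = \left(2^{19}(p-1)n^{14}\right)^{-1}$ and $C_0 = 320 (p-1)^{\frac13} n^{\frac{14}{3}}$. If $1 < p < 2$ and $d(K, B_p^n) > (1-\varepsilon)n$ for some $0 \leq \varepsilon \leq \varepsilon_0$, then $$d(K, S_n) \leq 1 + C_0 \varepsilon^{\frac{1}{q+1}},$$ where $q = p^* = \frac{p}{p-1}$, $\varepsilon_0 = \left(80^{q+1} \cdot q \cdot n^{5q+4}\right)^{-1}$ and $C_0 = 160 \cdot n^{\frac{q}{q+1}+4} \cdot \left(q (q-1)^{q-1}\right)^{\frac{1}{q+1}}$.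
   Context: A convex body in $\mathbb{R}^n$ is a compact convex set with non-empty interior. $S_n$ denotes the regular simplex in $\mathbb{R}^n$, and $B_p^n = \{x \in \mathbb{R}^n : |x_1|^p + \ldots + |x_n|^p \leq 1\}$. The Banach-Mazur distance of convex bodies $K, L \subset \mathbb{R}^n$ is $d(K,L) = \inf\{ r > 0 : K+u \subset T(L+v) \subset r(K+u)\}$, the infimum being over all invertible linear operators $T:\mathbb{R}^n\to\mathbb{R}^n$ and all $u,v\in\mathbb{R}^n$. *)

theory Defs
  imports "HOL-Analysis.Analysis"
begin

definition convex_body :: "'a::euclidean_space set \<Rightarrow> bool" where
  "convex_body K \<longleftrightarrow> compact K \<and> convex K \<and> interior K \<noteq> {}"

definition banach_mazur_dist :: "'a::euclidean_space set \<Rightarrow> 'a set \<Rightarrow> real" where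
  "banach_mazur_dist K L =
     Inf {r. r > 0 \<and> (\<exists>T u v. linear T \<and> bij T \<and>
            (+) u ` K \<subseteq> T ` ((+) v ` L) \<and> T ` ((+) v ` L) \<subseteq> (*\<^sub>R) r ` ((+) u ` K))}"

definition lp_ball :: "real \<Rightarrow> (real ^ 'n) set" where
  "lp_ball p = {x. (\<Sum>i\<in>UNIV. \<bar>x $ i\<bar> powr p) \<le> 1}"

text \<open>Full-dimensional regular simplices are unique only up to similarity, and the
  Banach-Mazur distance is invariant under similarities, so ``the'' regular simplex is
  rendered as a predicate; the lemma below shows that it is inhabited in every dimension.\<close>

definition regular_simplex :: "'a::euclidean_space set \<Rightarrow> bool" where
  "regular_simplex S \<longleftrightarrow>
     (\<exists>C d. \<not> affine_dependent C \<and> card C = DIM('a) + 1 \<and> S = convex hull C \<and>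
        (\<forall>x\<in>C. \<forall>y\<in>C. x \<noteq> y \<longrightarrow> dist x y = d))"

lemma regular_simplex_imp_simplex:
  "regular_simplex S \<Longrightarrow> int DIM('a) simplex (S :: 'a::euclidean_space set)"
  unfolding regular_simplex_def simplex_def by force

lemma regular_simplex_exists: "\<exists>S :: 'a::euclidean_space set. regular_simplex S"
proof -
  define n where "n = real DIM('a)"
  define t where "t = (1 + sqrt (1 + n)) / n"
  define a :: 'a where "a = t *\<^sub>R One"
  have n: "n > 0" by (simp add: n_def)
  have t: "n * t = 1 + sqrt (1 + n)" using n by (simp add: t_def)
  have "(n * t - 1)\<^sup>2 = 1 + n" using n t by simp
  then have "n * (n * t\<^sup>2 - 2 * t) = n * 1" by (simp add: power2_eq_square algebra_simps)
  then have quad: "n * t\<^sup>2 - 2 * t = 1" using n by (metis less_irrefl mult_left_cancel)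
  have One_Basis: "One \<bullet> b = 1" "b \<bullet> One = 1" if "b \<in> Basis" for b :: 'a
    using that by (simp_all add: inner_commute[of b One])
  have One_One: "One \<bullet> (One :: 'a) = n"
    by (subst inner_sum_left) (simp add: n_def One_Basis)
  have hull: "affine hull Basis \<subseteq> {x :: 'a. One \<bullet> x = 1}"
    by (rule hull_minimal) (auto simp: affine_hyperplane One_Basis)
  have "One \<bullet> a \<noteq> 1" using n t by (simp add: a_def One_One mult.commute)
  then have notin: "a \<notin> affine hull Basis" using hull by blast
  then have notin': "a \<notin> Basis" by (meson hull_inc)
  have ind: "\<not> affine_dependent (insert a Basis)"
    using notin affine_dependent_imp_dependent independent_Basis affine_independent_insert by blast
  have da: "dist a b = sqrt 2" if "b \<in> Basis" for b :: 'a
  proof -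
    have "(a - b) \<bullet> (a - b) = n * t\<^sup>2 - 2 * t + 1"
      unfolding a_def using that
      by (simp add: inner_diff_left inner_diff_right One_One One_Basis power2_eq_square algebra_simps
          del: inner_sum_left_Basis)
    then show ?thesis using quad by (simp add: dist_norm norm_eq_sqrt_inner)
  qed
  have db: "dist b c = sqrt 2" if "b \<in> Basis" "c \<in> Basis" "b \<noteq> c" for b c :: 'a
    using that by (simp add: dist_norm norm_eq_sqrt_inner inner_diff_left inner_diff_right inner_Basis)
  have "regular_simplex (convex hull insert a Basis)"
    unfolding regular_simplex_def
    by (rule exI[of _ "insert a Basis"], rule exI[of _ "sqrt 2"])
      (use ind notin' da db in \<open>auto simp: dist_commute[of _ a]\<close>)
  then show ?thesis ..
qed

end

theory Submission
  imports Defs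
begin

text \<open>Write \<open>L\<close> for the unit ball of the \<open>p\<close>-norm.  The distance is invariant under affine maps of \<open>K\<close>,
so \<open>L\<close> may be assumed to have maximal volume among its affine images inside \<open>K\<close>.  The first-order
condition for this maximum (\<open>john_decomposition\<close>) gives contact points \<open>x i \<in> L\<close>, functionals
\<open>y i\<close> in the polar of \<open>K\<close> with \<open>x i \<bullet> y i = 1\<close>, and weights \<open>c i\<close> of total mass \<open>n\<close> such that
\<open>\<Sum> c i y i = 0\<close> and \<open>\<Sum> c i (a \<bullet> y i) x i = a\<close> for all \<open>a\<close>.  Expanding the product shows, with \<open>z = \<Sum> c i x i\<close>,
that the nonnegative number
\<open>gap v u = \<Sum> c i (1 - v \<bullet> y i) (1 + x i \<bullet> u)\<close>
equals \<open>n + z \<bullet> u - v \<bullet> u\<close> for \<open>v\<close> in \<open>K\<close> and \<open>u\<close> in the polar of \<open>L\<close>.  This is the classical proof of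
\<open>K \<subseteq> z + n L\<close>.

If the distance is at least \<open>n - e\<close>, no translate of a slightly smaller multiple of \<open>L\<close> covers \<open>K\<close>, so there
are pairs \<open>(v, u)\<close> with tiny gap; moving the covering body in a direction \<open>w\<close> moreover forces \<open>w \<bullet> u\<close> to be almost
nonpositive (\<open>nearly_extremal_pair\<close>).  A tiny gap means that, up to a small weight, every contact
either has \<open>v\<close> almost on its supporting hyperplane or has \<open>x i \<bullet> u\<close> close to \<open>-1\<close>.  In the second case smoothness of
\<open>L\<close> puts \<open>y i\<close> close to \<open>- u\<close>; these contacts form the cluster of \<open>u\<close>.  As long as there are at most \<open>n\<close> disjoint
clusters, they cannot carry the whole weight, because they would then resolve the identity on a proper
subspace only (\<open>weight_outside_clusters\<close>).  This yields a direction \<open>w\<close> that is bounded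
away from the old clusters (\<open>next_direction\<close>) and hence a further pair with a new cluster.  In
this way one reaches \<open>n + 1\<close> pairs with disjoint clusters (\<open>separated_extremal_pairs\<close>).

Choose one contact functional in each cluster.  The \<open>j\<close>-th functional is almost \<open>1\<close> at all the points \<open>v k\<close>
except \<open>v j\<close>.  So \<open>K\<close> lies between the simplex spanned by the points \<open>v k\<close> and the simplex cut out by
the functionals, and these two nearly coincide (\<open>dist_simplex_le_of_dominant_slacks\<close>).

Smoothness enters only through the fixed radius \<open>1 / (50 n\<^sup>2)\<close> that makes clusters disjoint, so the resulting bound
\<open>banach_mazur_stability\<close> is linear in \<open>e\<close>.  For the \<open>p\<close>-norms the required smoothness follows from uniform
convexity of the dual norm.  A bound linear in \<open>\<epsilon>\<close> that holds up to \<open>\<epsilon>\<^sub>0\<close> implies the bounds with \<open>\<epsilon>\<close> to the power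
\<open>1/3\<close> or \<open>1/(q+1)\<close>, since \<open>\<epsilon>/\<epsilon>\<^sub>0\<close> is at most any of its roots.\<close>

section \<open>Polar sets and the Banach-Mazur distance\<close>

definition polar :: "'a::euclidean_space set \<Rightarrow> 'a set" where
  "polar A = {y. \<forall>x\<in>A. x \<bullet> y \<le> 1}"

lemma polarD: "y \<in> polar A \<Longrightarrow> x \<in> A \<Longrightarrow> x \<bullet> y \<le> 1"
  by (simp add: polar_def)

lemma polar_mono: "A \<subseteq> B \<Longrightarrow> polar B \<subseteq> polar A"
  by (auto simp: polar_def)

lemma zero_in_polar: "0 \<in> polar A"
  by (simp add: polar_def)

lemma polar_uminus: "(\<And>x. x \<in> A \<Longrightarrow> - x \<in> A) \<Longrightarrow> y \<in> polar A \<Longrightarrow> - y \<in> polar A"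
  by (force simp: polar_def)

lemma closed_polar: "closed (polar A)"
proof -
  have "polar A = (\<Inter>x\<in>A. {y. x \<bullet> y \<le> 1})"
    by (auto simp: polar_def)
  then show ?thesis
    by (simp add: closed_halfspace_le closed_INT)
qed

lemma compact_polar:
  assumes "0 \<in> interior A"
  shows "compact (polar A)"
proof -
  obtain r where r: "r > 0" "cball 0 r \<subseteq> A"
    using assms by (meson mem_interior_cball)
  have "norm y \<le> 1 / r" if y: "y \<in> polar A" for y
  proof (cases "y = 0")
    case False
    have "(r / norm y) *\<^sub>R y \<in> A"
      using r False by (intro subsetD[OF r(2)]) auto
    then have "(r / norm y) *\<^sub>R y \<bullet> y \<le> 1"
      by (rule polarD[OF y])
    then have "r * norm y \<le> 1"
      using False by (simp add: dot_square_norm power2_eq_square)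
    then show ?thesis
      using r by (simp add: field_simps)
  qed (use r in auto)
  then have "bounded (polar A)"
    by (auto simp: bounded_iff)
  then show ?thesis
    by (simp add: compact_eq_bounded_closed closed_polar)
qed

text \<open>The half of the bipolar theorem that needs an argument: a separating hyperplane, scaled so that it lies at level
\<open>1\<close>, belongs to the polar set.\<close>

lemma bipolar:
  assumes "closed A" "convex A" "0 \<in> A" and x: "\<And>y. y \<in> polar A \<Longrightarrow> x \<bullet> y \<le> 1"
  shows "x \<in> A"
proof (rule ccontr)
  assume "x \<notin> A"
  then obtain a b where ab: "a \<bullet> x < b" "\<And>v. v \<in> A \<Longrightarrow> a \<bullet> v > b"
    using separating_hyperplane_closed_point[OF assms(2,1)] by blast
  have b: "b < 0"
    using ab(2)[OF assms(3)] by simp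
  have "(1 / b) *\<^sub>R a \<in> polar A"
    unfolding polar_def using ab(2) b by (auto simp: inner_commute field_simps intro: less_imp_le)
  from x[OF this] show False
    using ab(1) b by (simp add: inner_commute field_simps)
qed

lemma banach_mazur_dist_le:
  assumes "r > 0" "linear T" "bij T" "(+) u ` K \<subseteq> T ` ((+) v ` L)" "T ` ((+) v ` L) \<subseteq> (*\<^sub>R) r ` ((+) u ` K)"
  shows "banach_mazur_dist K L \<le> r"
  unfolding banach_mazur_dist_def
  by (rule cInf_lower) (use assms in \<open>auto intro!: bdd_belowI[of _ 0]\<close>)

lemma bij_linear_compose:
  fixes A B :: "'a::euclidean_space \<Rightarrow> 'a"
  assumes "linear A" "bij A" "linear B" "bij B"
  shows "linear (A \<circ> B)" "bij (A \<circ> B)"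
  using assms by (auto intro: linear_compose bij_comp)

lemma affine_image_homothety:
  fixes K L :: "'a::euclidean_space set" and A :: "'a \<Rightarrow> 'a"
  assumes A: "linear A" "bij A"
    and K: "\<exists>T u v. linear T \<and> bij T \<and> (+) u ` K \<subseteq> T ` ((+) v ` L) \<and> T ` ((+) v ` L) \<subseteq> (*\<^sub>R) r ` ((+) u ` K)"
  shows "\<exists>T u v. linear T \<and> bij T \<and> (+) u ` ((\<lambda>x. A x + b) ` K) \<subseteq> T ` ((+) v ` L) \<and>
    T ` ((+) v ` L) \<subseteq> (*\<^sub>R) r ` ((+) u ` ((\<lambda>x. A x + b) ` K))"
proof -
  obtain T u v where T: "linear T" "bij T" "(+) u ` K \<subseteq> T ` ((+) v ` L)" "T ` ((+) v ` L) \<subseteq> (*\<^sub>R) r ` ((+) u ` K)"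
    using K by blast
  have tr: "(+) (A u - b) ` ((\<lambda>x. A x + b) ` K) = A ` ((+) u ` K)"
    by (simp add: image_image linear_add[OF A(1)] algebra_simps)
  have sc: "(*\<^sub>R) r ` A ` M = A ` (*\<^sub>R) r ` M" for M
    by (simp add: image_image linear_scale[OF A(1)])
  have "(+) (A u - b) ` ((\<lambda>x. A x + b) ` K) \<subseteq> (A \<circ> T) ` ((+) v ` L)"
    unfolding tr image_comp[symmetric] using T(3) by (rule image_mono)
  moreover have "(A \<circ> T) ` ((+) v ` L) \<subseteq> (*\<^sub>R) r ` ((+) (A u - b) ` ((\<lambda>x. A x + b) ` K))"
    unfolding tr sc image_comp[symmetric] using T(4) by (rule image_mono)
  ultimately show ?thesis
    using bij_linear_compose[OF A T(1,2)] by blast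
qed

lemma banach_mazur_dist_affine_image:
  fixes K L :: "'a::euclidean_space set" and A :: "'a \<Rightarrow> 'a"
  assumes A: "linear A" "bij A"
  shows "banach_mazur_dist ((\<lambda>x. A x + b) ` K) L = banach_mazur_dist K L"
proof -
  have inv: "linear (inv A)" "bij (inv A)"
  proof -
    have A_inv: "A (inv A x) = x" and inv_A: "inv A (A x) = x" for x
      using A(2) by (simp_all add: bij_is_surj surj_f_inv_f bij_is_inj)
    show "linear (inv A)"
      by (rule linearI) (metis A_inv inv_A linear_add[OF A(1)], metis A_inv inv_A linear_scale[OF A(1)])
    show "bij (inv A)"
      using A(2) by (rule bij_imp_bij_inv)
  qed
  have undo: "(\<lambda>x. inv A x + - inv A b) ` (\<lambda>x. A x + b) ` K = K"
    using A(2) by (simp add: image_image linear_add[OF inv(1)] bij_is_inj)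
  let ?P = "\<lambda>K r. \<exists>T u v. linear T \<and> bij T \<and> (+) u ` K \<subseteq> T ` ((+) v ` L) \<and> T ` ((+) v ` L) \<subseteq> (*\<^sub>R) r ` ((+) u ` K)"
  have "?P ((\<lambda>x. A x + b) ` K) r = ?P K r" for r
  proof
    assume "?P ((\<lambda>x. A x + b) ` K) r"
    from affine_image_homothety[OF inv this, of "- inv A b"] show "?P K r"
      unfolding undo .
  next
    assume "?P K r"
    from affine_image_homothety[OF A this, of b] show "?P ((\<lambda>x. A x + b) ` K) r" .
  qed
  then show ?thesis
    unfolding banach_mazur_dist_def by (simp only:)
qed

text \<open>The outer copy of \<open>L\<close> need not be concentric with the inner one: the map \<open>x \<mapsto> z + r x\<close> has a fixed
point when \<open>r > 1\<close>, and moving this point to the origin turns it into multiplication by \<open>r\<close>.\<close>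

lemma banach_mazur_dist_sandwich:
  fixes K L :: "'a::euclidean_space set"
  assumes "L \<subseteq> K" "K \<subseteq> (\<lambda>x. z + r *\<^sub>R x) ` L" "r > 1"
  shows "banach_mazur_dist K L \<le> r"
proof -
  \<comment> \<open>the fixed point is \<open>- u\<close>\<close>
  define u where "u = (1 / (r - 1)) *\<^sub>R z"
  have u: "z + u = r *\<^sub>R u"
  proof -
    have "(r - 1) *\<^sub>R u = z"
      using assms(3) by (simp add: u_def)
    then show ?thesis
      by (metis add.commute diff_add_cancel scaleR_diff_left scaleR_one)
  qed
  show ?thesis
  proof (rule banach_mazur_dist_le)
    show "r > 0" using assms(3) by simp
    show "linear ((*\<^sub>R) r :: 'a \<Rightarrow> 'a)"
      by (rule linear_scale_self)
    show "bij ((*\<^sub>R) r :: 'a \<Rightarrow> 'a)"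
      using assms(3) by (intro o_bij[of "(*\<^sub>R) (1/r)"]) auto
    show "(*\<^sub>R) r ` (+) u ` L \<subseteq> (*\<^sub>R) r ` (+) u ` K"
      using assms(1) by blast
    show "(+) u ` K \<subseteq> (*\<^sub>R) r ` (+) u ` L"
    proof clarify
      fix x assume "x \<in> K"
      then obtain l where l: "l \<in> L" "x = z + r *\<^sub>R l"
        using assms(2) by blast
      have "u + x = r *\<^sub>R (u + l)"
        using u l(2) by (simp add: algebra_simps)
      then show "u + x \<in> (*\<^sub>R) r ` (+) u ` L"
        using l(1) by blast
    qed
  qed
qed

section \<open>Bodies squeezed onto a simplex\<close>

text \<open>Linear extension of \<open>f k - f 0 \<mapsto> X k - X 0\<close>, where \<open>f\<close> enumerates the vertices of the regular simplex.
Affine independence is assumed for the family \<open>X\<close> rather than for its range; this includes injectivity.\<close>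

lemma simplex_affine_image:
  fixes S :: "'a::euclidean_space set" and X :: "nat \<Rightarrow> 'a"
  assumes S: "regular_simplex S"
    and X: "\<And>\<beta>. (\<Sum>k\<le>DIM('a). \<beta> k) = 0 \<Longrightarrow> (\<Sum>k\<le>DIM('a). \<beta> k *\<^sub>R X k) = 0 \<Longrightarrow> \<forall>k\<le>DIM('a). \<beta> k = 0"
  obtains T b where "linear T" "bij T" "convex hull (X ` {..DIM('a)}) = (\<lambda>s. T s + b) ` S"
proof -
  let ?n = "DIM('a)"
  obtain C where C: "\<not> affine_dependent C" "card C = ?n + 1" "S = convex hull C"
    using S unfolding regular_simplex_def by blast
  have "finite C"
    using C(2) by (metis Suc_eq_plus1 card.infinite nat.distinct(1))
  then obtain f where f: "bij_betw f {..?n} C"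
    using C(2) by (metis atLeast0AtMost bij_betw_from_nat_into_finite card_atMost finite_atMost Suc_eq_plus1 finite_same_card_bij)
  define B where "B = (\<lambda>k. f k - f 0) ` {1..?n}"
  have inj: "inj_on f {..?n}" and img: "f ` {..?n} = C"
    using f by (auto simp: bij_betw_def)
  have f0: "f 0 \<in> C"
    using img by auto
  have inj1: "inj_on (\<lambda>k. f k - f 0) {1..?n}"
    using inj by (auto simp: inj_on_def)
  have "(\<lambda>x. - f 0 + x) ` (C - {f 0}) = B"
  proof -
    have "C - {f 0} = f ` {1..?n}"
      proof -
      have "{..?n} = insert 0 {1..?n}" by auto
      then have "C = insert (f 0) (f ` {1..?n})" using img by auto
      moreover have "f 0 \<notin> f ` {1..?n}" using inj_onD[OF inj, of 0] by fastforce
      ultimately show ?thesis by auto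
    qed
    then show ?thesis
      by (simp add: B_def image_image)
  qed
  then have indB: "independent B"
    using C(1) f0 by (metis affine_dependent_iff_dependent2)
  obtain T where T: "linear T" "\<And>v. v \<in> B \<Longrightarrow> T v = X (the_inv_into {1..?n} (\<lambda>k. f k - f 0) v) - X 0"
    using linear_independent_extend[OF indB, of "\<lambda>v. X (the_inv_into {1..?n} (\<lambda>k. f k - f 0) v) - X 0"] by blast
  have Tf: "T (f k - f 0) = X k - X 0" if "k \<le> ?n" for k
  proof (cases "k = 0")
    case False
    then have "k \<in> {1..?n}" using that by auto
    then show ?thesis
      using T(2)[of "f k - f 0"] the_inv_into_f_f[OF inj1] by (auto simp: B_def)
  qed (simp add: linear_0[OF T(1)])
  have spanB: "span B = UNIV"
  proof -
    have "card B = ?n"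
      using inj1 by (simp add: B_def card_image)
    then show ?thesis
      using indB by (metis card_eq_dim dim_UNIV dim_eq_full indep_card_eq_dim_span dim_span)
  qed
  have "inj T"
    unfolding linear_injective_0[OF T(1)]
  proof clarify
    fix v assume v: "T v = 0"
    have "v \<in> span B" using spanB by simp
    then obtain \<gamma> where "v = (\<Sum>w\<in>B. \<gamma> w *\<^sub>R w)"
      by (subst (asm) span_finite) (auto simp: B_def)
    moreover have "(\<Sum>w\<in>B. \<gamma> w *\<^sub>R w) = (\<Sum>k\<in>{1..?n}. \<gamma> (f k - f 0) *\<^sub>R (f k - f 0))"
      unfolding B_def by (subst sum.reindex[OF inj1]) simp
    ultimately have veq: "v = (\<Sum>k\<in>{1..?n}. \<gamma> (f k - f 0) *\<^sub>R (f k - f 0))" by simp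
    define \<beta> where "\<beta> k = (if k = 0 then - (\<Sum>k\<in>{1..?n}. \<gamma> (f k - f 0)) else \<gamma> (f k - f 0))" for k
    have split: "(\<Sum>k\<le>?n. g k) = g 0 + (\<Sum>k\<in>{1..?n}. g k)" for g :: "nat \<Rightarrow> 'b::comm_monoid_add"
      by (simp add: atMost_atLeast0 sum.atLeast_Suc_atMost)
    have "(\<Sum>k\<in>{1..?n}. \<beta> k) = (\<Sum>k\<in>{1..?n}. \<gamma> (f k - f 0))"
      by (rule sum.cong) (auto simp: \<beta>_def)
    then have "(\<Sum>k\<le>?n. \<beta> k) = 0"
      by (simp add: split \<beta>_def)
    moreover have "(\<Sum>k\<le>?n. \<beta> k *\<^sub>R X k) = 0"
    proof -
      have "0 = T v" using v by simp
      also have "\<dots> = (\<Sum>k\<in>{1..?n}. \<gamma> (f k - f 0) *\<^sub>R (X k - X 0))"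
        unfolding veq linear_sum[OF T(1)] by (rule sum.cong) (auto simp: linear_scale[OF T(1)] Tf)
      also have "\<dots> = (\<Sum>k\<in>{1..?n}. \<beta> k *\<^sub>R X k) + \<beta> 0 *\<^sub>R X 0"
        by (simp add: \<beta>_def scaleR_diff_right sum_subtractf scaleR_sum_left)
      finally show ?thesis by (simp add: split add.commute)
    qed
    ultimately have "\<forall>k\<le>?n. \<beta> k = 0" by (rule X)
    then have "\<gamma> (f k - f 0) = 0" if "k \<in> {1..?n}" for k
      using that by (auto simp: \<beta>_def split: if_splits)
    then show "v = 0" unfolding veq by simp
  qed
  then have "bij T"
    using T(1) by (simp add: bij_def linear_injective_imp_surjective)
  moreover have "convex hull (X ` {..?n}) = (\<lambda>s. T s + (X 0 - T (f 0))) ` S"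
  proof -
    have "X ` {..?n} = (\<lambda>s. T s + (X 0 - T (f 0))) ` C"
    proof -
      have "X k = T (f k) + (X 0 - T (f 0))" if "k \<le> ?n" for k
        using Tf[OF that] linear_diff[OF T(1), of "f k" "f 0"] by (metis add.commute add_diff_eq diff_add_cancel)
      then show ?thesis
        unfolding img[symmetric] image_image by (intro image_cong[OF refl]) (unfold atMost_iff)
    qed
    also have "\<dots> = (+) (X 0 - T (f 0)) ` T ` C"
      by (simp add: image_image add.commute)
    also have "convex hull \<dots> = (+) (X 0 - T (f 0)) ` T ` S"
      unfolding C(3) by (simp add: convex_hull_translation convex_hull_linear_image[OF T(1)])
    finally show ?thesis
      by (simp add: image_image add.commute)
  qed
  ultimately show thesis
    using T(1) that by blast
qed

text \<open>The matrix of the slacks \<open>1 - X k \<bullet> g j\<close> is diagonally dominant, so the points \<open>X k\<close> are affinely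
independent.  Write a point of \<open>K\<close> in barycentric coordinates with respect to them and let \<open>j\<close> be the index of the
smallest coordinate.  Its slack at \<open>g j\<close> is nonnegative, and dominance turns this into a lower bound \<open>- m\<close> for that
coordinate.  The region where all coordinates are at least \<open>- m\<close> is the simplex enlarged by the factor
\<open>1 + (n + 1) m\<close> about its centroid.\<close>

lemma dist_simplex_le_of_dominant_slacks:
  fixes K S :: "'a::euclidean_space set" and X g :: "nat \<Rightarrow> 'a"
  defines "n \<equiv> DIM('a)"
  assumes K: "convex K" and S: "regular_simplex S"
    and XK: "\<And>k. k \<le> n \<Longrightarrow> X k \<in> K" and gK: "\<And>j v. j \<le> n \<Longrightarrow> v \<in> K \<Longrightarrow> v \<bullet> g j \<le> 1"
    and pos: "\<And>j. j \<le> n \<Longrightarrow> 1 - X j \<bullet> g j > 0"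
    and dom: "\<And>j. j \<le> n \<Longrightarrow> (\<Sum>k\<in>{..n}-{j}. 1 - X k \<bullet> g j) \<le> \<theta> * (1 - X j \<bullet> g j)"
    and \<theta>: "\<theta> \<ge> 0" "n * \<theta> < 1"
  shows "banach_mazur_dist K S \<le> 1 + (n + 1) * \<theta> / (1 - n * \<theta>)"
proof -
  define h where "h j v = 1 - v \<bullet> g j" for j v
  have n1: "n \<ge> 1" using DIM_positive[where 'a='a] by (simp add: n_def)
  have th1: "\<theta> < 1"
  proof (rule ccontr)
    assume "\<not> \<theta> < 1"
    then have "n * \<theta> \<ge> 1 * 1" using n1 by (intro mult_mono) auto
    then show False using \<theta> by simp
  qed
  have h_nonneg: "h j v \<ge> 0" if "j \<le> n" "v \<in> K" for j v
    using gK that by (simp add: h_def)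
  have hX: "h j (X k) \<ge> 0" if "j \<le> n" "k \<le> n" for j k
    using h_nonneg XK that by blast
  have h_comb: "(\<Sum>k\<le>n. \<beta> k * h j (X k)) = (\<Sum>k\<le>n. \<beta> k) - (\<Sum>k\<le>n. \<beta> k *\<^sub>R X k) \<bullet> g j" for \<beta> j
    by (simp add: h_def algebra_simps sum_subtractf inner_sum_left)
  have split: "(\<Sum>k\<le>n. \<beta> k * h j (X k)) = \<beta> j * h j (X j) + (\<Sum>k\<in>{..n}-{j}. \<beta> k * h j (X k))" if "j \<le> n" for \<beta> j
    using that by (intro sum.remove) auto
  have ind: "\<forall>k\<le>n. \<beta> k = 0" if \<beta>: "(\<Sum>k\<le>n. \<beta> k) = 0" "(\<Sum>k\<le>n. \<beta> k *\<^sub>R X k) = 0" for \<beta>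
  proof -
    have "\<exists>j\<in>{..n}. \<forall>k\<in>{..n}. \<bar>\<beta> k\<bar> \<le> \<bar>\<beta> j\<bar>"
      using Max_in[of "(\<lambda>k. \<bar>\<beta> k\<bar>) ` {..n}"] Max_ge[of "(\<lambda>k. \<bar>\<beta> k\<bar>) ` {..n}"] by fastforce
    then obtain j where j: "j \<le> n" "\<And>k. k \<le> n \<Longrightarrow> \<bar>\<beta> k\<bar> \<le> \<bar>\<beta> j\<bar>" by auto
    have "\<beta> j * h j (X j) = - (\<Sum>k\<in>{..n}-{j}. \<beta> k * h j (X k))"
      using h_comb[of \<beta> j] split[OF j(1), of \<beta>] \<beta> by simp
    then have "\<bar>\<beta> j\<bar> * h j (X j) = \<bar>\<Sum>k\<in>{..n}-{j}. \<beta> k * h j (X k)\<bar>"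
      using hX[of j j] j(1) by (metis abs_minus abs_mult abs_of_nonneg)
    also have "\<dots> \<le> (\<Sum>k\<in>{..n}-{j}. \<bar>\<beta> j\<bar> * h j (X k))"
      using hX j by (intro order_trans[OF sum_abs] sum_mono) (auto simp: abs_mult intro!: mult_right_mono)
    also have "\<dots> \<le> \<bar>\<beta> j\<bar> * (\<theta> * h j (X j))"
      unfolding sum_distrib_left[symmetric] using dom[OF j(1)] by (intro mult_left_mono) (auto simp: h_def)
    finally have "\<bar>\<beta> j\<bar> * h j (X j) * (1 - \<theta>) \<le> 0" by (simp add: algebra_simps)
    moreover have "h j (X j) * (1 - \<theta>) > 0" using pos[OF j(1)] th1 by (simp add: h_def)
    ultimately have "\<bar>\<beta> j\<bar> \<le> 0"
      by (metis mult.assoc mult_le_0_iff not_less abs_ge_zero)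
    then show ?thesis using j by force
  qed
  obtain T b where T: "linear T" "bij T" "convex hull (X ` {..n}) = (\<lambda>s. T s + b) ` S"
    using simplex_affine_image[OF S, of X] ind unfolding n_def by blast
  have onto: "\<exists>\<beta>. (\<Sum>k\<le>n. \<beta> k) = 1 \<and> (\<Sum>k\<le>n. \<beta> k *\<^sub>R X k) = p" for p
  proof -
    have injX: "inj_on X {..n}"
    proof (rule inj_onI, rule ccontr)
      fix i k assume ik: "i \<in> {..n}" "k \<in> {..n}" "X i = X k" "i \<noteq> k"
      \<comment> \<open>equal points would satisfy the affine relation \<open>X i - X k = 0\<close>\<close>
      let ?b = "\<lambda>l. if l = i then 1 else if l = k then -1 else 0::real"
      have e: "(\<Sum>l\<le>n. ?b l *\<^sub>R Y l) = Y i - Y k" for Y :: "nat \<Rightarrow> 'b::real_vector"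
      proof -
        have "(\<Sum>l\<le>n. ?b l *\<^sub>R Y l) = (\<Sum>l\<in>{i,k}. ?b l *\<^sub>R Y l)"
          using ik by (intro sum.mono_neutral_right) auto
        also have "\<dots> = Y i - Y k" using ik by simp
        finally show ?thesis .
      qed
      have "\<forall>l\<le>n. ?b l = 0"
        by (rule ind) (use e[of X] e[of "\<lambda>_. 1::real"] ik in auto)
      then show False using ik by (metis atMost_iff zero_neq_one)
    qed
    have "\<not> affine_dependent (X ` {..n})"
    proof
      assume "affine_dependent (X ` {..n})"
      then obtain U where U: "sum U (X ` {..n}) = 0" "\<exists>v\<in>X ` {..n}. U v \<noteq> 0" "(\<Sum>v\<in>X ` {..n}. U v *\<^sub>R v) = 0"
        by (subst (asm) affine_dependent_explicit_finite) auto
      have "\<forall>k\<le>n. U (X k) = 0"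
        by (rule ind) (use U in \<open>simp_all add: sum.reindex[OF injX]\<close>)
      then show False using U(2) by auto
    qed
    moreover have "card (X ` {..n}) = n + 1" using injX by (simp add: card_image)
    ultimately have "aff_dim (X ` {..n}) = n"
      by (simp add: affine_independent_iff_card)
    then have "affine hull (X ` {..n}) = UNIV" by (simp add: aff_dim_eq_full n_def)
    then have "p \<in> affine hull (X ` {..n})" by simp
    then obtain u where "sum u (X ` {..n}) = 1" "(\<Sum>v\<in>X ` {..n}. u v *\<^sub>R v) = p"
      by (subst (asm) affine_hull_finite) auto
    then show ?thesis
      by (intro exI[of _ "\<lambda>k. u (X k)"]) (simp add: sum.reindex[OF injX])
  qed
  define m where "m = \<theta> / (1 - n * \<theta>)"
  define r where "r = 1 + (n + 1) * m"
  have m0: "m \<ge> 0" using \<theta> by (simp add: m_def)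
  have coord: "\<beta> k \<ge> - m" if \<beta>: "(\<Sum>k\<le>n. \<beta> k) = 1" "(\<Sum>k\<le>n. \<beta> k *\<^sub>R X k) \<in> K" and k: "k \<le> n" for \<beta> k
  proof -
    have "\<exists>j\<in>{..n}. \<forall>k\<in>{..n}. \<beta> j \<le> \<beta> k"
      using Min_in[of "\<beta> ` {..n}"] Min_le[of "\<beta> ` {..n}"] by fastforce
    then obtain j where j: "j \<le> n" "\<And>k. k \<le> n \<Longrightarrow> \<beta> j \<le> \<beta> k" by auto
    show ?thesis
    proof (cases "\<beta> j \<ge> 0")
      case True then show ?thesis using j(2)[OF k] m0 by linarith
    next
      case False
      define t where "t = - \<beta> j"
      have t: "t > 0" "\<And>k. k \<le> n \<Longrightarrow> - t \<le> \<beta> k" using False j by (auto simp: t_def)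
      \<comment> \<open>all coordinates are at least \<open>- t\<close> and they add up to \<open>1\<close>\<close>
      have ub: "\<beta> i \<le> 1 + n * t" if "i \<le> n" for i
      proof -
        have "(\<Sum>k\<le>n. \<beta> k) = \<beta> i + (\<Sum>k\<in>{..n}-{i}. \<beta> k)" using that by (intro sum.remove) auto
        moreover have "(\<Sum>k\<in>{..n}-{i}. \<beta> k) \<ge> (\<Sum>k\<in>{..n}-{i}. - t)"
          using t by (intro sum_mono) auto
        moreover have "(\<Sum>k\<in>{..n}-{i}. - t) = - (n * t)" using that by simp
        ultimately show ?thesis using \<beta>(1) by linarith
      qed
      have "0 \<le> h j (\<Sum>k\<le>n. \<beta> k *\<^sub>R X k)" using h_nonneg j \<beta> by blast
      also have "\<dots> = (\<Sum>k\<le>n. \<beta> k * h j (X k))" unfolding h_comb using \<beta>(1) by (simp add: h_def)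
      also have "\<dots> = - t * h j (X j) + (\<Sum>k\<in>{..n}-{j}. \<beta> k * h j (X k))" using split[OF j(1)] by (simp add: t_def)
      also have "(\<Sum>k\<in>{..n}-{j}. \<beta> k * h j (X k)) \<le> (\<Sum>k\<in>{..n}-{j}. (1 + n * t) * h j (X k))"
        using ub hX j by (intro sum_mono mult_right_mono) auto
      also have "\<dots> \<le> (1 + n * t) * (\<theta> * h j (X j))"
        unfolding sum_distrib_left[symmetric] using dom[OF j(1)] t(1) by (intro mult_left_mono) (auto simp: h_def)
      finally have "0 \<le> ((1 + n * t) * \<theta> - t) * h j (X j)" by (simp add: algebra_simps)
      then have "(1 + n * t) * \<theta> - t \<ge> 0"
        using pos[OF j(1)] by (simp add: h_def zero_le_mult_iff)
      then have "t * (1 - n * \<theta>) \<le> \<theta>" by (simp add: algebra_simps)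
      then have "t \<le> m" using \<theta> by (simp add: m_def pos_le_divide_eq)
      then show ?thesis using j(2)[OF k] by (simp add: t_def)
    qed
  qed
  \<comment> \<open>the centroid, which is the centre of the enlargement\<close>
  define xb where "xb = (1 / (n + 1)) *\<^sub>R (\<Sum>k\<le>n. X k)"
  have rpos: "r > 0" using m0 by (simp add: r_def add_pos_nonneg)
  let ?H = "convex hull (X ` {..n})"
  have sub1: "?H \<subseteq> K" using K XK by (intro hull_minimal) auto
  have sub2: "(+) (- xb) ` K \<subseteq> (*\<^sub>R) r ` (+) (- xb) ` ?H"
  proof clarify
    fix p assume p: "p \<in> K"
    obtain \<beta> where \<beta>: "(\<Sum>k\<le>n. \<beta> k) = 1" "(\<Sum>k\<le>n. \<beta> k *\<^sub>R X k) = p" using onto by blast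
    define s where "s = (\<Sum>k\<le>n. ((\<beta> k + m) / r) *\<^sub>R X k)"
    have "s \<in> ?H"
      unfolding s_def
    proof (rule convex_sum)
      show "(\<Sum>k\<le>n. (\<beta> k + m) / r) = 1"
        using \<beta>(1) rpos unfolding sum_divide_distrib[symmetric] by (simp add: sum.distrib r_def algebra_simps)
      show "(\<beta> k + m) / r \<ge> 0" if "k \<in> {..n}" for k
        using coord[of \<beta> k] \<beta> p that rpos by simp
    qed (auto intro: hull_inc)
    moreover have "- xb + p = r *\<^sub>R (- xb + s)"
    proof -
      have "r *\<^sub>R s = (\<Sum>k\<le>n. (\<beta> k + m) *\<^sub>R X k)" using rpos by (simp add: s_def scaleR_sum_right)
      also have "\<dots> = p + m *\<^sub>R (\<Sum>k\<le>n. X k)" using \<beta>(2) by (simp add: scaleR_add_left sum.distrib scaleR_sum_right)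
      also have "m *\<^sub>R (\<Sum>k\<le>n. X k) = (r - 1) *\<^sub>R xb" by (simp add: xb_def r_def)
      finally show ?thesis by (simp add: algebra_simps)
    qed
    ultimately show "- xb + p \<in> (*\<^sub>R) r ` (+) (- xb) ` ?H" by blast
  qed
  obtain v where v: "b - xb = T v" using T(2) by (metis bij_pointE)
  have HT: "(+) (- xb) ` ?H = T ` (+) v ` S"
    unfolding T(3) image_image using v by (intro image_cong) (auto simp: linear_add[OF T(1)] algebra_simps)
  have "banach_mazur_dist K S \<le> r"
  proof (rule banach_mazur_dist_le[OF rpos])
    let ?R = "(*\<^sub>R) r :: 'a \<Rightarrow> 'a"
    have "bij ?R" using rpos by (intro o_bij[of "(*\<^sub>R) (1/r)"]) auto
    then show "linear (?R \<circ> T)" "bij (?R \<circ> T)"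
      using bij_linear_compose[OF linear_scale_self _ T(1,2)] by blast+
    show "(+) (- xb) ` K \<subseteq> (?R \<circ> T) ` (+) v ` S"
      using sub2 unfolding HT by (simp add: image_comp)
    show "(?R \<circ> T) ` (+) v ` S \<subseteq> (*\<^sub>R) r ` (+) (- xb) ` K"
      unfolding image_comp[symmetric] HT[symmetric] using sub1 by blast
  qed
  then show ?thesis by (simp add: r_def m_def algebra_simps)
qed

section \<open>Contact decompositions and nearly extremal pairs\<close>

text \<open>Quantitative smoothness at scale \<open>(\<beta>, \<phi>)\<close>: a functional that almost supports \<open>L\<close> at \<open>x\<close> (up to \<open>\<beta>\<close>) is within \<open>\<phi>\<close> of
every supporting functional there, in the norm dual to \<open>L\<close>.\<close>

definition smooth_with :: "'a::euclidean_space set \<Rightarrow> real \<Rightarrow> real \<Rightarrow> bool" where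
  "smooth_with L \<beta> \<phi> \<longleftrightarrow> (\<forall>x\<in>L. \<forall>y\<in>polar L. \<forall>u\<in>polar L. x \<bullet> y = 1 \<longrightarrow> x \<bullet> u \<ge> 1 - \<beta> \<longrightarrow>
     (\<forall>w\<in>L. \<bar>w \<bullet> (y - u)\<bar> \<le> \<phi>))"

text \<open>John's decomposition of the identity for a symmetric body \<open>L\<close> inside \<open>K\<close>: the contact points \<open>x i\<close> and the common
supporting functionals \<open>y i\<close>.  The dimension \<open>n\<close> is a real parameter, as it enters only through inequalities.\<close>

locale contact_decomposition =
  fixes K L :: "'a::euclidean_space set" and I :: "'i set" and c :: "'i \<Rightarrow> real" and x y :: "'i \<Rightarrow> 'a" and n :: real
  assumes L: "compact L" "convex L" "0 \<in> interior L" "\<And>v. v \<in> L \<Longrightarrow> - v \<in> L"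
    and LK: "L \<subseteq> K"
    and I: "finite I"
    and c_nonneg: "\<And>i. i \<in> I \<Longrightarrow> c i \<ge> 0" and xL: "\<And>i. i \<in> I \<Longrightarrow> x i \<in> L"
    and yK: "\<And>i. i \<in> I \<Longrightarrow> y i \<in> polar K" and xy: "\<And>i. i \<in> I \<Longrightarrow> x i \<bullet> y i = 1"
    and n_eq: "n = DIM('a)" and sum_c: "(\<Sum>i\<in>I. c i) = n" and sum_y: "(\<Sum>i\<in>I. c i *\<^sub>R y i) = 0"
    and resolution: "\<And>a. (\<Sum>i\<in>I. (c i * (a \<bullet> y i)) *\<^sub>R x i) = a"
begin

definition z :: 'a where "z = (\<Sum>i\<in>I. c i *\<^sub>R x i)"

abbreviation slack :: "'i \<Rightarrow> 'a \<Rightarrow> real" where "slack i v \<equiv> 1 - v \<bullet> y i"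

lemma L0: "0 \<in> L"
  using L(3) interior_subset by blast

lemma in_L_iff: "v \<in> L \<longleftrightarrow> (\<forall>u\<in>polar L. v \<bullet> u \<le> 1)"
  using bipolar[OF compact_imp_closed[OF L(1)] L(2) L0] polarD by blast

lemma yL: "i \<in> I \<Longrightarrow> y i \<in> polar L"
  using yK polar_mono[OF LK] by blast

lemma polar_neg: "u \<in> polar L \<Longrightarrow> - u \<in> polar L"
  using polar_uminus L(4) by blast

lemma abs_le_1: "v \<in> L \<Longrightarrow> u \<in> polar L \<Longrightarrow> \<bar>v \<bullet> u\<bar> \<le> 1"
  using polarD[of u L v] polarD[of "- u" L v] polar_neg[of u] by force

lemma slack_nonneg: "i \<in> I \<Longrightarrow> v \<in> K \<Longrightarrow> slack i v \<ge> 0"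
  using polarD[OF yK] by force

lemma n_pos: "n \<ge> 1"
  unfolding n_eq using DIM_positive[where 'a='a] by linarith

lemma sum_inner_y: "(\<Sum>i\<in>I. c i * (v \<bullet> y i)) = 0"
proof -
  have "v \<bullet> (\<Sum>i\<in>I. c i *\<^sub>R y i) = (\<Sum>i\<in>I. c i * (v \<bullet> y i))"
    by (simp add: inner_sum_right)
  then show ?thesis by (simp add: sum_y)
qed

lemma sum_slack: "(\<Sum>i\<in>I. c i * slack i v) = n"
  by (simp add: algebra_simps sum_subtractf sum_c sum_inner_y)

lemma sum_inner_xy: "(\<Sum>i\<in>I. c i * (v \<bullet> y i) * (x i \<bullet> u)) = v \<bullet> u"
proof -
  have "(\<Sum>i\<in>I. (c i * (v \<bullet> y i)) *\<^sub>R x i) \<bullet> u = (\<Sum>i\<in>I. c i * (v \<bullet> y i) * (x i \<bullet> u))"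
    by (simp add: inner_sum_left)
  then show ?thesis by (simp add: resolution)
qed

definition gap :: "'a \<Rightarrow> 'a \<Rightarrow> real" where
  "gap v u = (\<Sum>i\<in>I. c i * slack i v * (1 + x i \<bullet> u))"

text \<open>In the expanded product the three nonconstant sums are evaluated by the definition of \<open>z\<close>, by \<open>\<Sum> c i y i = 0\<close> and by the
resolution of the identity.\<close>

lemma gap_eq: "gap v u = n + z \<bullet> u - v \<bullet> u"
proof -
  have "gap v u = (\<Sum>i\<in>I. c i) + (\<Sum>i\<in>I. c i * (x i \<bullet> u)) - (\<Sum>i\<in>I. c i * (v \<bullet> y i)) - (\<Sum>i\<in>I. c i * (v \<bullet> y i) * (x i \<bullet> u))"
    unfolding gap_def sum.distrib[symmetric] sum_subtractf[symmetric] by (rule sum.cong) (auto simp: algebra_simps)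
  then show ?thesis
    by (simp add: sum_c sum_inner_y sum_inner_xy z_def inner_sum_left)
qed

lemma one_plus_nonneg: "i \<in> I \<Longrightarrow> u \<in> polar L \<Longrightarrow> 1 + x i \<bullet> u \<ge> 0"
  using abs_le_1[OF xL] by force

lemma gap_nonneg: "v \<in> K \<Longrightarrow> u \<in> polar L \<Longrightarrow> gap v u \<ge> 0"
  unfolding gap_def using slack_nonneg one_plus_nonneg c_nonneg
  by (intro sum_nonneg mult_nonneg_nonneg) auto

lemma abs_z_le: assumes "u \<in> polar L" shows "\<bar>z \<bullet> u\<bar> \<le> n"
proof -
  have "\<bar>z \<bullet> u\<bar> \<le> (\<Sum>i\<in>I. c i * 1)"
    unfolding z_def inner_sum_left using c_nonneg abs_le_1[OF xL assms]
    by (intro order_trans[OF sum_abs] sum_mono) (auto simp: abs_mult intro!: mult_left_le)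
  then show ?thesis by (simp add: sum_c)
qed

lemma inner_K_le: assumes "v \<in> K" "u \<in> polar L" shows "v \<bullet> u \<le> 2 * n"
  using gap_nonneg[OF assms] abs_z_le[OF assms(2)] by (simp add: gap_eq)

text \<open>Test the covering body centred at \<open>z + s w\<close>.  A point \<open>v\<close> outside it and a functional \<open>u\<close> separating them satisfy
\<open>0 \<le> gap v u < e - s (w \<bullet> u)\<close>.  So the shift, at the price of \<open>s\<close> in the gap, controls the sign of \<open>w \<bullet> u\<close> up to
\<open>e / s\<close>.\<close>

lemma nearly_extremal_pair:
  assumes e: "e > 0" "e < n" and s: "s > 0" and w: "w \<in> L"
    and not_covered: "\<And>z'. \<not> K \<subseteq> (\<lambda>v. z' + (n - e) *\<^sub>R v) ` L"
  obtains v u where "v \<in> K" "u \<in> polar L" "gap v u \<le> e + s" "w \<bullet> u < e / s"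
proof -
  obtain v where v: "v \<in> K" "v \<notin> (\<lambda>v. (z + s *\<^sub>R w) + (n - e) *\<^sub>R v) ` L"
    using not_covered[of "z + s *\<^sub>R w"] by blast
  define v' where "v' = (1 / (n - e)) *\<^sub>R (v - (z + s *\<^sub>R w))"
  have "v = (z + s *\<^sub>R w) + (n - e) *\<^sub>R v'" using e by (simp add: v'_def)
  then have "v' \<notin> L" using v(2) by blast
  then obtain u where u: "u \<in> polar L" "v' \<bullet> u > 1" using in_L_iff by force
  then have "(v - (z + s *\<^sub>R w)) \<bullet> u > n - e"
    using e by (simp add: v'_def less_divide_eq)
  then have less: "gap v u < e - s * (w \<bullet> u)"
    by (simp add: gap_eq inner_diff_left inner_add_left)
  have "s * (w \<bullet> u) < e" using less gap_nonneg[OF v(1) u(1)] by linarith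
  then have 1: "w \<bullet> u < e / s" using s by (simp add: field_simps)
  have "- 1 \<le> w \<bullet> u" using abs_le_1[OF w u(1)] by linarith
  then have "s * (- 1) \<le> s * (w \<bullet> u)" using s by (intro mult_left_mono) auto
  then have "gap v u \<le> e + s" using less by linarith
  then show thesis using that v(1) u(1) 1 by blast
qed

definition cluster :: "real \<Rightarrow> 'a \<Rightarrow> 'i set" where
  "cluster \<beta> u = {i \<in> I. 1 + x i \<bullet> u \<le> \<beta>}"

lemma cluster_I: "cluster \<beta> u \<subseteq> I"
  by (auto simp: cluster_def)

text \<open>Outside the cluster the second factor of each term of the gap exceeds \<open>\<beta>\<close>.\<close>

lemma slack_outside_cluster:
  assumes \<beta>: "\<beta> > 0" and vu: "v \<in> K" "u \<in> polar L" "gap v u \<le> \<eta>"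
  shows "(\<Sum>i\<in>I - cluster \<beta> u. c i * slack i v) \<le> \<eta> / \<beta>"
proof -
  have "\<beta> * (\<Sum>i\<in>I - cluster \<beta> u. c i * slack i v) \<le> (\<Sum>i\<in>I - cluster \<beta> u. c i * slack i v * (1 + x i \<bullet> u))"
    unfolding sum_distrib_left
  proof (rule sum_mono)
    fix i assume i: "i \<in> I - cluster \<beta> u"
    then have "(c i * slack i v) * \<beta> \<le> (c i * slack i v) * (1 + x i \<bullet> u)"
      using c_nonneg slack_nonneg vu(1) by (intro mult_left_mono) (auto simp: cluster_def)
    then show "\<beta> * (c i * slack i v) \<le> c i * slack i v * (1 + x i \<bullet> u)" by (simp add: mult.commute)
  qed
  also have "\<dots> \<le> gap v u"
    unfolding gap_def using I c_nonneg slack_nonneg one_plus_nonneg vu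
    by (intro sum_mono2) auto
  finally show ?thesis using \<beta> vu(3) by (simp add: field_simps)
qed

lemma slack_inside_cluster:
  assumes "\<beta> > 0" "v \<in> K" "u \<in> polar L" "gap v u \<le> \<eta>"
  shows "(\<Sum>i\<in>cluster \<beta> u. c i * slack i v) \<ge> n - \<eta> / \<beta>"
proof -
  have "(\<Sum>i\<in>I. c i * slack i v) = (\<Sum>i\<in>I - cluster \<beta> u. c i * slack i v) + (\<Sum>i\<in>cluster \<beta> u. c i * slack i v)"
    using I cluster_I by (intro sum.subset_diff) auto
  then show ?thesis using slack_outside_cluster[OF assms] sum_slack[of v] by linarith
qed

lemma cluster_close:
  assumes "smooth_with L \<beta> \<phi>" "u \<in> polar L" "i \<in> cluster \<beta> u" "w \<in> L"
  shows "\<bar>w \<bullet> y i + w \<bullet> u\<bar> \<le> \<phi>"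
proof -
  have i: "i \<in> I" using assms(3) by (simp add: cluster_def)
  have "x i \<bullet> (- u) \<ge> 1 - \<beta>" using assms(3) by (simp add: cluster_def)
  then have "\<bar>w \<bullet> (y i - (- u))\<bar> \<le> \<phi>"
    using assms(1,4) xL[OF i] yL[OF i] polar_neg[OF assms(2)] xy[OF i] unfolding smooth_with_def by blast
  then show ?thesis by (simp add: inner_add_right)
qed

text \<open>At most \<open>n\<close> functionals have differences spanning a proper subspace; take \<open>w \<in> L\<close> orthogonal to it and \<open>w'\<close> in the polar of
\<open>L\<close> with \<open>w \<bullet> w' = 1\<close>.  Since \<open>c\<close>, \<open>x\<close> and \<open>y\<close> have the centred moments \<open>\<Sum> c i (x i - z/n) = 0\<close> and \<open>\<Sum> c i y i = 0\<close>,
the identity \<open>1 = \<Sum> c i (w \<bullet> y i) (x i \<bullet> w')\<close> survives shifting \<open>y i\<close> by \<open>u 0\<close> and \<open>x i\<close> by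
\<open>- z/n\<close>.  Now every contact inside a cluster contributes at most \<open>2 \<phi>\<close> times its weight, so the others must carry
weight.\<close>

lemma weight_outside_clusters:
  fixes u :: "nat \<Rightarrow> 'a"
  assumes sm: "smooth_with L \<beta> \<phi>" and \<phi>: "\<phi> \<ge> 0" and m: "m \<ge> 1" "m \<le> DIM('a)"
    and u: "\<And>j. j < m \<Longrightarrow> u j \<in> polar L"
  shows "(\<Sum>i\<in>I - (\<Union>j<m. cluster \<beta> (u j)). c i) \<ge> (1 - 2 * n * \<phi>) / 4"
proof -
  let ?U = "\<Union>j<m. cluster \<beta> (u j)"
  have "dim ((\<lambda>j. u j - u 0) ` {1..<m}) \<le> card ((\<lambda>j. u j - u 0) ` {1..<m})" by (rule dim_le_card') simp
  also have "\<dots> \<le> m - 1" using card_image_le[of "{1..<m}" "\<lambda>j. u j - u 0"] by simp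
  also have "\<dots> < DIM('a)" using m by linarith
  finally obtain w0 where w0: "w0 \<noteq> 0" "\<And>v. v \<in> span ((\<lambda>j. u j - u 0) ` {1..<m}) \<Longrightarrow> orthogonal w0 v"
    using orthogonal_to_subspace_exists by blast
  have w0u: "w0 \<bullet> u j = w0 \<bullet> u 0" if "j < m" for j
  proof (cases "j = 0")
    case False
    then have "orthogonal w0 (u j - u 0)" using that by (intro w0(2) span_base) auto
    then show ?thesis by (simp add: orthogonal_def inner_diff_right)
  qed simp
  have "continuous_on (polar L) (\<lambda>v. w0 \<bullet> v)" by (intro continuous_intros)
  moreover have "polar L \<noteq> {}" using zero_in_polar by blast
  ultimately obtain w' where w': "w' \<in> polar L" "\<And>v. v \<in> polar L \<Longrightarrow> w0 \<bullet> v \<le> w0 \<bullet> w'"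
    using continuous_attains_sup[OF compact_polar[OF L(3)]] by blast
  define \<tau> where "\<tau> = w0 \<bullet> w'"
  \<comment> \<open>otherwise arbitrarily large multiples of \<open>w0\<close> would lie in \<open>L\<close>\<close>
  have \<tau>: "\<tau> > 0"
  proof (rule ccontr)
    assume neg: "\<not> \<tau> > 0"
    obtain R where R: "\<And>v. v \<in> L \<Longrightarrow> norm v \<le> R" "R > 0" using compact_imp_bounded[OF L(1)] by (auto simp: bounded_pos)
    have "(2 * R / norm w0) *\<^sub>R w0 \<in> L"
      unfolding in_L_iff
    proof
      fix v assume "v \<in> polar L"
      then have "w0 \<bullet> v \<le> 0" using w'(2) neg by (force simp: \<tau>_def)
      then have "(2 * R / norm w0) * (w0 \<bullet> v) \<le> 0" using R(2) by (intro mult_nonneg_nonpos) auto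
      then show "((2 * R / norm w0) *\<^sub>R w0) \<bullet> v \<le> 1" by simp
    qed
    from R(1)[OF this] show False using R(2) w0(1) by simp
  qed
  define w where "w = (1 / \<tau>) *\<^sub>R w0"
  have wL: "w \<in> L" unfolding in_L_iff w_def using w'(2) \<tau> by (simp add: \<tau>_def)
  have ww': "w \<bullet> w' = 1" using \<tau> by (simp add: w_def \<tau>_def)
  have wu: "w \<bullet> u j = w \<bullet> u 0" if "j < m" for j using w0u[OF that] by (simp add: w_def)
  have u0: "u 0 \<in> polar L" using u m by simp
  have "1 = (\<Sum>i\<in>I. c i * (w \<bullet> y i) * (x i \<bullet> w'))" using sum_inner_xy ww' by simp
  also have "\<dots> = (\<Sum>i\<in>I. c i * (w \<bullet> y i + w \<bullet> u 0) * (x i \<bullet> w' - (z \<bullet> w') / n))"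
  proof -
    have "(\<Sum>i\<in>I. c i * (w \<bullet> y i + w \<bullet> u 0) * (x i \<bullet> w' - (z \<bullet> w') / n)) =
      (\<Sum>i\<in>I. c i * (w \<bullet> y i) * (x i \<bullet> w')) - (\<Sum>i\<in>I. c i * (w \<bullet> y i)) * ((z \<bullet> w') / n)
       + ((\<Sum>i\<in>I. c i * (x i \<bullet> w')) - (\<Sum>i\<in>I. c i) * ((z \<bullet> w') / n)) * (w \<bullet> u 0)"
      unfolding sum_distrib_right sum.distrib[symmetric] sum_subtractf[symmetric] by (rule sum.cong) (auto simp: algebra_simps)
    moreover have "(\<Sum>i\<in>I. c i * (x i \<bullet> w')) = z \<bullet> w'" by (simp add: z_def inner_sum_left)
    ultimately show ?thesis using n_pos by (simp add: sum_inner_y sum_c)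
  qed
  also have "\<dots> \<le> (\<Sum>i\<in>I. c i * (if i \<in> ?U then 2 * \<phi> else 4))"
  proof (rule sum_mono)
    fix i assume i: "i \<in> I"
    have "\<bar>z \<bullet> w'\<bar> / n \<le> 1" using abs_z_le[OF w'(1)] n_pos by (simp add: field_simps)
    then have "\<bar>x i \<bullet> w' - (z \<bullet> w') / n\<bar> \<le> 2" using abs_le_1[OF xL[OF i] w'(1)] n_pos
      using abs_divide[of "z \<bullet> w'" n] by linarith
    moreover have "\<bar>w \<bullet> y i + w \<bullet> u 0\<bar> \<le> (if i \<in> ?U then \<phi> else 2)"
    proof (cases "i \<in> ?U")
      case True
      then obtain j where j: "j < m" "i \<in> cluster \<beta> (u j)" by auto
      then show ?thesis using cluster_close[OF sm u[OF j(1)] j(2) wL] wu[OF j(1)] True by simp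
    next
      case False
      then show ?thesis using abs_le_1[OF wL yL[OF i]] abs_le_1[OF wL u0] by auto
    qed
    ultimately have "\<bar>w \<bullet> y i + w \<bullet> u 0\<bar> * \<bar>x i \<bullet> w' - (z \<bullet> w') / n\<bar> \<le> (if i \<in> ?U then \<phi> else 2) * 2"
      using \<phi> by (intro mult_mono) auto
    then have "(w \<bullet> y i + w \<bullet> u 0) * (x i \<bullet> w' - (z \<bullet> w') / n) \<le> (if i \<in> ?U then 2 * \<phi> else 4)"
      unfolding abs_mult[symmetric] by (auto split: if_splits)
    then show "c i * (w \<bullet> y i + w \<bullet> u 0) * (x i \<bullet> w' - (z \<bullet> w') / n) \<le> c i * (if i \<in> ?U then 2 * \<phi> else 4)"
      using c_nonneg[OF i] by (simp only: mult.assoc mult_left_mono)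
  qed
  also have "\<dots> \<le> (\<Sum>i\<in>I. c i * (2 * \<phi>)) + (\<Sum>i\<in>I. if i \<in> ?U then 0 else c i * 4)"
    unfolding sum.distrib[symmetric] using c_nonneg \<phi> by (intro sum_mono) auto
  also have "(\<Sum>i\<in>I. if i \<in> ?U then 0 else c i * 4) = 4 * (\<Sum>i\<in>I - ?U. c i)"
  proof -
    have "(\<Sum>i\<in>I. if i \<in> ?U then 0 else c i * 4) = (\<Sum>i\<in>I - ?U. c i * 4)"
      using I by (intro sum.mono_neutral_cong_right) auto
    then show ?thesis by (simp add: sum_distrib_left mult.commute)
  qed
  also have "(\<Sum>i\<in>I. c i * (2 * \<phi>)) = n * (2 * \<phi>)" by (simp add: sum_distrib_right[symmetric] sum_c)
  finally show ?thesis by simp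
qed

text \<open>The direction is \<open>W = \<Sum> a j v j\<close>, where \<open>a j\<close> is the weight of the \<open>j\<close>-th cluster, scaled into \<open>L\<close>.  On
cluster \<open>l\<close> the average of \<open>W \<bullet> y i\<close> is at most \<open>\<Sum> a j\<close> minus \<open>a l\<close> times the average slack at \<open>v l\<close>, and this
product is almost \<open>n\<close>.  Hence the average is at most minus the weight outside the clusters, up to \<open>\<eta> / \<beta>\<close>.  As \<open>y i\<close> is close
to \<open>- u l\<close> on that cluster, \<open>W \<bullet> u l\<close> is bounded below.\<close>

lemma next_direction:
  fixes u v :: "nat \<Rightarrow> 'a"
  assumes sm: "smooth_with L \<beta> \<phi>" and \<phi>: "\<phi> \<ge> 0" and \<beta>: "\<beta> > 0" and \<kappa>: "\<eta> / \<beta> < n"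
    and m: "m \<le> DIM('a)"
    and vu: "\<And>j. j < m \<Longrightarrow> v j \<in> K" "\<And>j. j < m \<Longrightarrow> u j \<in> polar L" "\<And>j. j < m \<Longrightarrow> gap (v j) (u j) \<le> \<eta>"
    and disj: "disjoint_family_on (\<lambda>j. cluster \<beta> (u j)) {..<m}"
  obtains w where "w \<in> L" "\<And>l. l < m \<Longrightarrow> w \<bullet> u l \<ge> ((1 - 2 * n * \<phi>) / 4 - \<eta> / \<beta>) / (2 * n\<^sup>2) - \<phi>"
proof -
  define A where "A j = cluster \<beta> (u j)" for j
  define a where "a j = (\<Sum>i\<in>A j. c i)" for j
  have AI: "A j \<subseteq> I" for j using cluster_I by (simp add: A_def)
  have finA: "finite (A j)" for j using AI I finite_subset by blast
  have a_nonneg: "a j \<ge> 0" for j unfolding a_def using c_nonneg AI by (intro sum_nonneg) auto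
  have sum_a: "(\<Sum>j<m. a j) + (\<Sum>i\<in>I - (\<Union>j<m. A j). c i) = n"
  proof -
    have "(\<Sum>j<m. a j) = (\<Sum>i\<in>(\<Union>j<m. A j). c i)"
      unfolding a_def using finA disj
      by (intro sum.UNION_disjoint[symmetric]) (auto simp: disjoint_family_on_def A_def)
    moreover have "(\<Sum>i\<in>I. c i) = (\<Sum>i\<in>I - (\<Union>j<m. A j). c i) + (\<Sum>i\<in>(\<Union>j<m. A j). c i)"
      using I AI by (intro sum.subset_diff) auto
    ultimately show ?thesis by (simp add: sum_c)
  qed
  have sum_a_le: "(\<Sum>j<m. a j) \<le> n"
    using sum_a sum_nonneg[of "I - (\<Union>j<m. A j)" c] c_nonneg by auto
  define w where "w = (1 / (2 * n\<^sup>2)) *\<^sub>R (\<Sum>j<m. a j *\<^sub>R v j)"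
  have R: "2 * n\<^sup>2 > 0" using n_pos by simp
  have wL: "w \<in> L"
    unfolding in_L_iff
  proof
    fix q assume q: "q \<in> polar L"
    have "(\<Sum>j<m. a j *\<^sub>R v j) \<bullet> q \<le> (\<Sum>j<m. a j * (2 * n))"
      unfolding inner_sum_left using a_nonneg inner_K_le[OF vu(1) q]
      by (intro sum_mono) (auto intro!: mult_left_mono)
    also have "\<dots> = (\<Sum>j<m. a j) * (2 * n)" by (simp add: sum_distrib_right)
    also have "\<dots> \<le> n * (2 * n)" using sum_a_le n_pos by (intro mult_right_mono) auto
    finally show "w \<bullet> q \<le> 1" using R by (simp add: w_def power2_eq_square)
  qed
  have "w \<bullet> u l \<ge> ((1 - 2 * n * \<phi>) / 4 - \<eta> / \<beta>) / (2 * n\<^sup>2) - \<phi>" if l: "l < m" for l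
  proof -
    let ?W = "\<Sum>j<m. a j *\<^sub>R v j" and ?C = "\<Sum>i\<in>I - (\<Union>j<m. A j). c i"
    have C: "?C \<ge> (1 - 2 * n * \<phi>) / 4"
      unfolding A_def using weight_outside_clusters[OF sm \<phi> _ m vu(2)] l by simp
    have in_slack: "(\<Sum>i\<in>A l. c i * slack i (v l)) \<ge> n - \<eta> / \<beta>"
      unfolding A_def using slack_inside_cluster[OF \<beta> vu(1)[OF l] vu(2)[OF l] vu(3)[OF l]] .
    have al: "a l > 0"
    proof (rule ccontr)
      assume "\<not> a l > 0"
      then have "a l = 0" using a_nonneg[of l] by simp
      then have "\<forall>i\<in>A l. c i = 0" unfolding a_def using c_nonneg AI finA by (subst (asm) sum_nonneg_eq_0_iff) auto
      then show False using in_slack \<kappa> by simp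
    qed
    have "(\<Sum>i\<in>A l. c i * (?W \<bullet> y i)) \<le> (\<Sum>i\<in>A l. c i * ((\<Sum>j<m. a j) - a l * slack i (v l)))"
    proof (rule sum_mono, rule mult_left_mono)
      fix i assume "i \<in> A l"
      then have i: "i \<in> I" using AI by blast
      show "c i \<ge> 0" using c_nonneg[OF i] .
      have "?W \<bullet> y i = (\<Sum>j<m. a j) - (\<Sum>j<m. a j * slack i (v j))"
        by (simp add: inner_sum_left algebra_simps sum_subtractf)
      moreover have "a l * slack i (v l) \<le> (\<Sum>j<m. a j * slack i (v j))"
        using l a_nonneg slack_nonneg[OF i] vu(1) by (intro member_le_sum) auto
      ultimately show "?W \<bullet> y i \<le> (\<Sum>j<m. a j) - a l * slack i (v l)" by simp
    qed
    also have "\<dots> = a l * (\<Sum>j<m. a j) - a l * (\<Sum>i\<in>A l. c i * slack i (v l))"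
    proof -
      have "(\<Sum>i\<in>A l. c i * (q - t * g i)) = a l * q - t * (\<Sum>i\<in>A l. c i * g i)" for q t g
        unfolding a_def sum_distrib_left sum_distrib_right sum_subtractf[symmetric]
        by (rule sum.cong) (auto simp: algebra_simps)
      then show ?thesis .
    qed
    also have "\<dots> \<le> a l * (\<Sum>j<m. a j) - a l * (n - \<eta> / \<beta>)"
      using in_slack a_nonneg by (intro diff_left_mono mult_left_mono) auto
    also have "\<dots> = a l * (\<eta> / \<beta> - ?C)"
    proof -
      have "p * q - p * (n - t) = p * (t - r)" if "q + r = n" for p q r t :: real
        unfolding that[symmetric] by (simp add: algebra_simps)
      then show ?thesis using sum_a by blast
    qed
    finally have up: "(\<Sum>i\<in>A l. c i * (?W \<bullet> y i)) \<le> a l * (\<eta> / \<beta> - ?C)" .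
    have "a l * (- (w \<bullet> u l) - \<phi>) = (\<Sum>i\<in>A l. c i * (- (w \<bullet> u l) - \<phi>))" by (simp add: a_def sum_distrib_right)
    also have "\<dots> \<le> (\<Sum>i\<in>A l. c i * (w \<bullet> y i))"
    proof (rule sum_mono, rule mult_left_mono)
      fix i assume i: "i \<in> A l"
      then show "c i \<ge> 0" using c_nonneg AI by blast
      show "- (w \<bullet> u l) - \<phi> \<le> w \<bullet> y i"
        using cluster_close[OF sm vu(2)[OF l] i[unfolded A_def] wL] by linarith
    qed
    also have "\<dots> = (\<Sum>i\<in>A l. c i * (?W \<bullet> y i)) / (2 * n\<^sup>2)"
      unfolding w_def sum_divide_distrib by (rule sum.cong) auto
    also have "\<dots> \<le> a l * (\<eta> / \<beta> - ?C) / (2 * n\<^sup>2)" using up R by (intro divide_right_mono) auto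
    finally have "- (w \<bullet> u l) - \<phi> \<le> (\<eta> / \<beta> - ?C) / (2 * n\<^sup>2)"
      using al by (simp add: times_divide_eq_right[symmetric] del: times_divide_eq_right)
    also have "\<dots> \<le> (\<eta> / \<beta> - (1 - 2 * n * \<phi>) / 4) / (2 * n\<^sup>2)" using C R by (intro divide_right_mono) auto
    also have "\<dots> = - (((1 - 2 * n * \<phi>) / 4 - \<eta> / \<beta>) / (2 * n\<^sup>2))" by (simp add: diff_divide_distrib)
    finally show ?thesis by linarith
  qed
  then show thesis using that wL by blast
qed

text \<open>The direction from the preceding lemma satisfies \<open>w \<bullet> u l \<ge> 4 \<phi>\<close> for the old functionals, where \<open>\<phi> = 1 / (50 n\<^sup>2)\<close>, while a new
pair can be found with \<open>w \<bullet> u' < 2 \<phi>\<close>.  A contact common to an old and the new cluster would bring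
\<open>u l\<close> and \<open>u'\<close> within \<open>2 \<phi>\<close> of each other.\<close>

lemma separated_extremal_pairs:
  assumes n2: "n \<ge> 2" and e: "e > 0" "e < 1"
    and not_covered: "\<And>z'. \<not> K \<subseteq> (\<lambda>v. z' + (n - e) *\<^sub>R v) ` L"
    and sm: "smooth_with L \<beta> (1 / (50 * n\<^sup>2))" and \<beta>: "\<beta> > 0"
    and \<eta>: "\<eta> = e + 25 * n\<^sup>2 * e" "\<eta> / \<beta> \<le> 1 / 32"
    and m: "m \<le> DIM('a) + 1"
  shows "\<exists>v u. (\<forall>j<m. v j \<in> K \<and> u j \<in> polar L \<and> gap (v j) (u j) \<le> \<eta>) \<and>
    disjoint_family_on (\<lambda>j. cluster \<beta> (u j)) {..<m}"
  using m
proof (induction m)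
  case 0
  then show ?case by (auto simp: disjoint_family_on_def)
next
  case (Suc m)
  then obtain v u where IH: "\<And>j. j < m \<Longrightarrow> v j \<in> K" "\<And>j. j < m \<Longrightarrow> u j \<in> polar L" "\<And>j. j < m \<Longrightarrow> gap (v j) (u j) \<le> \<eta>"
    "disjoint_family_on (\<lambda>j. cluster \<beta> (u j)) {..<m}" by auto
  define \<phi> where "\<phi> = 1 / (50 * n\<^sup>2)"
  have \<phi>: "\<phi> \<ge> 0" by (simp add: \<phi>_def)
  have "\<eta> / \<beta> < n" using \<eta>(2) n2 by linarith
  then obtain w where w: "w \<in> L" "\<And>l. l < m \<Longrightarrow> w \<bullet> u l \<ge> ((1 - 2 * n * \<phi>) / 4 - \<eta> / \<beta>) / (2 * n\<^sup>2) - \<phi>"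
    using next_direction[OF sm[folded \<phi>_def] \<phi> \<beta> _ _ IH] Suc.prems by auto
  \<comment> \<open>chosen so that \<open>e / s = 2 \<phi>\<close>\<close>
  define s where "s = 25 * n\<^sup>2 * e"
  have n0: "n\<^sup>2 > 0" using n2 by simp
  have s: "s > 0" using e n0 by (simp add: s_def)
  have en: "e < n" using e(2) n2 by linarith
  obtain v' u' where new: "v' \<in> K" "u' \<in> polar L" "gap v' u' \<le> e + s" "w \<bullet> u' < e / s"
    by (rule nearly_extremal_pair[OF e(1) en s w(1) not_covered])
  have wu': "w \<bullet> u' < 2 * \<phi>" using new(4) e n0 by (simp add: s_def \<phi>_def field_simps)
  have big: "((1 - 2 * n * \<phi>) / 4 - \<eta> / \<beta>) / (2 * n\<^sup>2) \<ge> 5 * \<phi>"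
  proof -
    have "2 * n * \<phi> \<le> 1 / 50"
      using n2 n0 by (simp add: \<phi>_def field_simps power2_eq_square)
    then have "(1 - 2 * n * \<phi>) / 4 - \<eta> / \<beta> \<ge> 2 / 10"
    proof -
      have "(1 - t) / 4 - k \<ge> 2 / 10" if "t \<le> 1 / 50" "k \<le> 1 / 32" for t k :: real
        using that by (simp add: diff_divide_distrib)
      then show ?thesis using \<open>2 * n * \<phi> \<le> 1 / 50\<close> \<eta>(2) by blast
    qed
    then have "((1 - 2 * n * \<phi>) / 4 - \<eta> / \<beta>) / (2 * n\<^sup>2) \<ge> (2 / 10) / (2 * n\<^sup>2)"
      using n0 by (intro divide_right_mono) auto
    then show ?thesis by (simp add: \<phi>_def)
  qed
  have disj: "cluster \<beta> (u l) \<inter> cluster \<beta> u' = {}" if l: "l < m" for l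
  proof (rule ccontr)
    assume "\<not> ?thesis"
    then obtain i where i: "i \<in> cluster \<beta> (u l)" "i \<in> cluster \<beta> u'" by blast
    show False
      using cluster_close[OF sm[folded \<phi>_def] IH(2)[OF l] i(1) w(1)]
        cluster_close[OF sm[folded \<phi>_def] new(2) i(2) w(1)] wu' w(2)[OF l] big by linarith
  qed
  show ?case
  proof (rule exI[of _ "v(m := v')"], rule exI[of _ "u(m := u')"], rule conjI)
    show "\<forall>j<Suc m. (v(m := v')) j \<in> K \<and> (u(m := u')) j \<in> polar L \<and> gap ((v(m := v')) j) ((u(m := u')) j) \<le> \<eta>"
    proof (intro allI impI)
      fix j assume "j < Suc m"
      then show "(v(m := v')) j \<in> K \<and> (u(m := u')) j \<in> polar L \<and> gap ((v(m := v')) j) ((u(m := u')) j) \<le> \<eta>"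
        using IH(1-3)[of j] new \<eta>(1) by (auto simp: less_Suc_eq s_def)
    qed
    show "disjoint_family_on (\<lambda>j. cluster \<beta> ((u(m := u')) j)) {..<Suc m}"
      unfolding disjoint_family_on_def
    proof (intro ballI impI)
      fix j k assume jk: "j \<in> {..<Suc m}" "k \<in> {..<Suc m}" "j \<noteq> k"
      consider "j < m" "k < m" | "j = m" "k < m" | "j < m" "k = m" using jk by force
      then show "cluster \<beta> ((u(m := u')) j) \<inter> cluster \<beta> ((u(m := u')) k) = {}"
      proof cases
        case 1
        then show ?thesis using IH(4) jk(3) by (auto simp: disjoint_family_on_def)
      next
        case 2
        then show ?thesis using disj[of k] by auto
      next
        case 3
        then show ?thesis using disj[of j] by auto
      qed
    qed
  qed
qed

text \<open>In cluster \<open>j\<close> the weighted sum of the slacks at \<open>v j\<close> is almost \<open>n\<close>, whereas for \<open>k \<noteq> j\<close> the weighted sum of the slacks at \<open>v k\<close> is at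
most \<open>\<kappa>\<close>, because the cluster is disjoint from that of \<open>u k\<close>.  By averaging, some contact of the cluster has a slack at \<open>v j\<close>
that dominates all the others together.\<close>

lemma dist_simplex_le_of_not_covered:
  assumes n2: "n \<ge> 2" and e: "e > 0" "e < 1"
    and not_covered: "\<And>z'. \<not> K \<subseteq> (\<lambda>v. z' + (n - e) *\<^sub>R v) ` L"
    and sm: "smooth_with L \<beta> (1 / (50 * n\<^sup>2))" and \<beta>: "\<beta> > 0"
    and small: "e < \<beta> / (416 * n ^ 3)"
    and K: "convex K" and S: "regular_simplex S"
  shows "banach_mazur_dist K S \<le> 1 + 156 * n ^ 3 * e / \<beta>"
proof -
  define \<eta> where "\<eta> = e + 25 * n\<^sup>2 * e"
  \<comment> \<open>a simpler upper bound for \<open>\<eta> / \<beta>\<close>\<close>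
  define \<kappa> where "\<kappa> = 26 * n\<^sup>2 * e / \<beta>"
  have n0: "n\<^sup>2 \<ge> 1" "n > 0" using n2 by auto
  have \<eta>\<kappa>: "\<eta> / \<beta> \<le> \<kappa>"
  proof -
    have "e \<le> n\<^sup>2 * e" using n0 e by simp
    then show ?thesis unfolding \<eta>_def \<kappa>_def using \<beta> by (intro divide_right_mono) (auto simp: algebra_simps)
  qed
  have \<kappa>0: "\<kappa> > 0" using e \<beta> n0 by (simp add: \<kappa>_def)
  have \<kappa>n: "\<kappa> * (16 * n) < 1"
    using small \<beta> n0 by (simp add: \<kappa>_def field_simps power2_eq_square power3_eq_cube)
  have \<kappa>32: "\<kappa> < 1 / 32"
  proof -
    have "\<kappa> * 32 \<le> \<kappa> * (16 * n)" using \<kappa>0 n2 by (intro mult_left_mono) auto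
    then show ?thesis using \<kappa>n by linarith
  qed
  have \<eta>32: "\<eta> / \<beta> \<le> 1 / 32" using \<eta>\<kappa> \<kappa>32 by linarith
  obtain v u where vu: "\<And>j. j \<le> DIM('a) \<Longrightarrow> v j \<in> K" "\<And>j. j \<le> DIM('a) \<Longrightarrow> u j \<in> polar L"
    "\<And>j. j \<le> DIM('a) \<Longrightarrow> gap (v j) (u j) \<le> \<eta>"
    and disj: "disjoint_family_on (\<lambda>j. cluster \<beta> (u j)) {..<DIM('a) + 1}"
    using separated_extremal_pairs[OF n2 e not_covered sm \<beta> \<eta>_def \<eta>32 order_refl]
    unfolding Suc_eq_plus1[symmetric] less_Suc_eq_le by blast
  define A where "A j = cluster \<beta> (u j)" for j
  have AI: "A j \<subseteq> I" for j using cluster_I by (simp add: A_def)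
  have "\<exists>i\<in>I. 1 - v j \<bullet> y i > 0 \<and> (\<Sum>k\<in>{..DIM('a)} - {j}. 1 - v k \<bullet> y i) \<le> 2 * \<kappa> * (1 - v j \<bullet> y i)"
    if j: "j \<le> DIM('a)" for j
  proof -
    have finA: "finite (A j)" using AI I finite_subset by blast
    have "(\<Sum>i\<in>A j. c i * slack i (v j)) \<ge> n - \<kappa>"
      using slack_inside_cluster[OF \<beta> vu(1)[OF j] vu(2)[OF j] vu(3)[OF j]] \<eta>\<kappa> by (simp add: A_def)
    moreover have "(\<Sum>i\<in>A j. c i * slack i (v k)) \<le> \<kappa>" if k: "k \<in> {..DIM('a)} - {j}" for k
    proof -
      have "A j \<subseteq> I - cluster \<beta> (u k)"
        using AI[of j] disjoint_family_onD[OF disj, of j k] k j by (auto simp: A_def)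
      then have "(\<Sum>i\<in>A j. c i * slack i (v k)) \<le> (\<Sum>i\<in>I - cluster \<beta> (u k). c i * slack i (v k))"
        using I c_nonneg slack_nonneg vu(1) k by (intro sum_mono2) auto
      then show ?thesis
        using slack_outside_cluster[OF \<beta> vu(1) vu(2) vu(3), of k] k \<eta>\<kappa> by fastforce
    qed
    then have "(\<Sum>k\<in>{..DIM('a)} - {j}. \<Sum>i\<in>A j. c i * slack i (v k)) \<le> (\<Sum>k\<in>{..DIM('a)} - {j}. \<kappa>)"
      by (rule sum_mono)
    then have "(\<Sum>i\<in>A j. \<Sum>k\<in>{..DIM('a)} - {j}. c i * slack i (v k)) \<le> n * \<kappa>"
      using j by (subst sum.swap) (simp add: n_eq)
    moreover have "(\<Sum>i\<in>A j. c i * (2 * \<kappa> * slack i (v j) - (\<Sum>k\<in>{..DIM('a)} - {j}. slack i (v k)))) =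
        2 * \<kappa> * (\<Sum>i\<in>A j. c i * slack i (v j)) - (\<Sum>i\<in>A j. \<Sum>k\<in>{..DIM('a)} - {j}. c i * slack i (v k))"
    proof -
      have "(\<Sum>i\<in>A j. c i * (t * g i - (\<Sum>k\<in>B. g' i k))) = t * (\<Sum>i\<in>A j. c i * g i) - (\<Sum>i\<in>A j. \<Sum>k\<in>B. c i * g' i k)"
        for t g g' and B :: "nat set"
        unfolding sum_distrib_left[of _ _ "A j"] sum_subtractf[symmetric]
        by (rule sum.cong) (auto simp: right_diff_distrib sum_distrib_left)
      then show ?thesis .
    qed
    ultimately have "(\<Sum>i\<in>A j. c i * (2 * \<kappa> * slack i (v j) - (\<Sum>k\<in>{..DIM('a)} - {j}. slack i (v k))))
        \<ge> 2 * \<kappa> * (n - \<kappa>) - n * \<kappa>"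
      using \<kappa>0 by (smt (verit) mult_left_mono)
    moreover have "2 * \<kappa> * (n - \<kappa>) - n * \<kappa> > 0"
    proof -
      have "2 * \<kappa> * (n - \<kappa>) - n * \<kappa> = \<kappa> * (n - 2 * \<kappa>)" by (simp add: algebra_simps)
      then show ?thesis using \<kappa>0 \<kappa>32 n2 by simp
    qed
    ultimately have "(\<Sum>i\<in>A j. c i * (2 * \<kappa> * slack i (v j) - (\<Sum>k\<in>{..DIM('a)} - {j}. slack i (v k)))) > 0" by linarith
    then obtain i where i: "i \<in> A j" "c i * (2 * \<kappa> * slack i (v j) - (\<Sum>k\<in>{..DIM('a)} - {j}. slack i (v k))) > 0"
      by (meson not_less sum_nonpos)
    have iI: "i \<in> I" using i(1) AI by blast
    have pos: "2 * \<kappa> * slack i (v j) - (\<Sum>k\<in>{..DIM('a)} - {j}. slack i (v k)) > 0"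
      using i(2) c_nonneg[OF iI] by (simp add: zero_less_mult_iff)
    moreover have "(\<Sum>k\<in>{..DIM('a)} - {j}. slack i (v k)) \<ge> 0"
      using slack_nonneg[OF iI] vu(1) by (intro sum_nonneg) auto
    ultimately have "2 * \<kappa> * slack i (v j) > 0" by linarith
    then have "slack i (v j) > 0" using \<kappa>0 by (simp add: zero_less_mult_iff)
    then show ?thesis using iI pos by (intro bexI[of _ i]) auto
  qed
  then obtain f where f: "\<And>j. j \<le> DIM('a) \<Longrightarrow> f j \<in> I" "\<And>j. j \<le> DIM('a) \<Longrightarrow> 1 - v j \<bullet> y (f j) > 0"
    "\<And>j. j \<le> DIM('a) \<Longrightarrow> (\<Sum>k\<in>{..DIM('a)} - {j}. 1 - v k \<bullet> y (f j)) \<le> 2 * \<kappa> * (1 - v j \<bullet> y (f j))"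
    by metis
  have half: "n * (2 * \<kappa>) \<le> 1 / 8" using \<kappa>n by (simp add: algebra_simps)
  have "banach_mazur_dist K S \<le> 1 + (n + 1) * (2 * \<kappa>) / (1 - n * (2 * \<kappa>))"
    unfolding n_eq
    by (rule dist_simplex_le_of_dominant_slacks[OF K S vu(1), where g = "\<lambda>j. y (f j)"])
      (use f half[unfolded n_eq] \<kappa>0 polarD[OF yK] in auto)
  also have "(n + 1) * (2 * \<kappa>) / (1 - n * (2 * \<kappa>)) \<le> 6 * n * \<kappa>"
  proof -
    have "(n + 1) * 2 \<le> 6 * n * (7 / 8)" using n2 by simp
    also have "\<dots> \<le> 6 * n * (1 - n * (2 * \<kappa>))" using half n0 by (intro mult_left_mono) auto
    finally have "(n + 1) * 2 * \<kappa> \<le> 6 * n * (1 - n * (2 * \<kappa>)) * \<kappa>"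
      using \<kappa>0 by (intro mult_right_mono) auto
    then show ?thesis using half by (subst pos_divide_le_eq) (auto simp: algebra_simps)
  qed
  also have "6 * n * \<kappa> = 156 * n ^ 3 * e / \<beta>" by (simp add: \<kappa>_def power2_eq_square power3_eq_cube)
  finally show ?thesis by simp
qed

end

section \<open>The contact decomposition of a maximal affine copy\<close>

text \<open>A permutation other than the identity moves at least two indices, so in every term of the product rule an off-diagonal
entry of the identity matrix survives as a factor.\<close>

lemma has_real_derivative_det_at_identity:
  fixes B :: "real^'n^'n"
  shows "((\<lambda>t. det (mat 1 + t *\<^sub>R B)) has_real_derivative trace B) (at 0)"
proof -
  let ?P = "{p. p permutes (UNIV :: 'n set)}"
  let ?D = "\<lambda>p. \<Sum>i\<in>UNIV. B $ i $ p i * (\<Prod>j\<in>UNIV - {i}. (mat 1 :: real^'n^'n) $ j $ p j)"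
  have "((\<lambda>t. \<Prod>i\<in>UNIV. (mat 1 + t *\<^sub>R B) $ i $ p i) has_real_derivative ?D p) (at 0)" for p
  proof -
    have "((\<lambda>t. (mat 1 + t *\<^sub>R B) $ i $ p i) has_real_derivative B $ i $ p i) (at 0)" for i
      by (auto intro!: derivative_eq_intros)
    then have "((\<lambda>t. \<Prod>i\<in>UNIV. (mat 1 + t *\<^sub>R B) $ i $ p i) has_real_derivative
        (\<Sum>i\<in>UNIV. B $ i $ p i * (\<Prod>j\<in>UNIV - {i}. (mat 1 + 0 *\<^sub>R B) $ j $ p j))) (at 0)"
      by (rule has_field_derivative_prod)
    then show ?thesis by simp
  qed
  then have "((\<lambda>t. det (mat 1 + t *\<^sub>R B)) has_real_derivative (\<Sum>p\<in>?P. of_int (sign p) * ?D p)) (at 0)"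
    unfolding det_def by (intro DERIV_sum DERIV_cmult) auto
  moreover have "(\<Sum>p\<in>?P. of_int (sign p) * ?D p) = (\<Sum>p\<in>{id}. of_int (sign p) * ?D p)"
  proof (rule sum.mono_neutral_right)
    show "\<forall>p\<in>?P - {id}. of_int (sign p) * ?D p = 0"
    proof
      fix p assume p: "p \<in> ?P - {id}"
      then obtain k where k: "p k \<noteq> k" by (auto simp: fun_eq_iff)
      have "inj p" using p by (auto simp: permutes_inj)
      then have k': "p (p k) \<noteq> p k" using k by (auto dest: injD)
      have "(\<Prod>j\<in>UNIV - {i}. (mat 1 :: real^'n^'n) $ j $ p j) = 0" for i
      proof -
        have "\<exists>j\<in>UNIV - {i}. (mat 1 :: real^'n^'n) $ j $ p j = 0"
        proof (cases "k = i")
          case True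
          then show ?thesis using k k' by (intro bexI[of _ "p k"]) (auto simp: mat_def)
        next
          case False
          then show ?thesis using k by (intro bexI[of _ k]) (auto simp: mat_def)
        qed
        then show ?thesis by (intro prod_zero) auto
      qed
      then have "?D p = 0" by (simp only: mult_zero_right sum.neutral_const)
      then show "of_int (sign p) * ?D p = 0" by (simp only: mult_zero_right)
    qed
  qed (auto simp: permutes_id)
  moreover have "(\<Sum>p\<in>{id}. of_int (sign p) * ?D p) = trace B"
    by (simp add: sign_id trace_def mat_def)
  ultimately show ?thesis by simp
qed

lemma continuous_on_det: "continuous_on A (det :: real^'n^'n \<Rightarrow> real)"
  unfolding det_def by (intro continuous_intros)

text \<open>The rank-one matrix that represents the functional \<open>B \<mapsto> y \<bullet> (B *v x)\<close> with respect to the inner product on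
matrices.\<close>

definition outer :: "real^'n \<Rightarrow> real^'n \<Rightarrow> real^'n^'n" where
  "outer y x = (\<chi> i. (y $ i) *\<^sub>R x)"

lemma inner_outer: "B \<bullet> outer y x = y \<bullet> (B *v x)"
  by (simp add: outer_def inner_vec_def matrix_vector_mult_def sum_distrib_left mult.commute mult.left_commute)

lemma inner_mat_1: "B \<bullet> (mat 1 :: real^'n^'n) = trace B"
  by (simp add: inner_vec_def mat_def trace_def if_distrib cong: if_cong)

lemma continuous_on_outer: "continuous_on A (\<lambda>p. outer (snd p) (fst p))"
  unfolding outer_def by (intro continuous_on_vec_lambda continuous_intros)

text \<open>The claim is that \<open>(I/n, 0)\<close> is a convex combination of the points \<open>(y \<otimes> x, y)\<close> that belong to contact pairs.  Otherwise
a separating functional, corrected by a multiple of the identity, is an infinitesimal affine motion \<open>(B, b)\<close> with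
positive trace that moves every contact strictly inwards.  By compactness a small such motion keeps \<open>L\<close> inside
\<open>K\<close>, but it increases the determinant.\<close>

lemma john_decomposition:
  fixes K L :: "(real^'n) set"
  assumes L: "compact L" "convex L" "0 \<in> interior L" "\<And>v. v \<in> L \<Longrightarrow> - v \<in> L"
    and K: "closed K" "convex K" and LK: "L \<subseteq> K"
    and max: "\<And>N d. (\<forall>x\<in>L. N *v x + d \<in> K) \<Longrightarrow> det N \<le> 1"
  shows "\<exists>(I :: ((real^'n^'n) \<times> (real^'n)) set) c x y. contact_decomposition K L I c x y (real CARD('n))"
proof -
  let ?n = "real CARD('n)"
  have n: "?n > 0" by simp
  have int0: "0 \<in> interior K" using L(3) LK by (meson interior_mono subsetD)
  then have K0: "0 \<in> K" using interior_subset by blast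
  have comp: "compact (L \<times> polar K)"
    using L(1) compact_polar[OF int0] by (rule compact_Times)
  define \<Gamma> where "\<Gamma> = {p \<in> L \<times> polar K. fst p \<bullet> snd p = 1}"
  define \<Phi> where "\<Phi> = (\<lambda>p. (outer (snd p) (fst p), snd p)) ` \<Gamma>"
  have "compact \<Gamma>"
  proof -
    have "\<Gamma> = (L \<times> polar K) \<inter> {p. fst p \<bullet> snd p = 1}" by (auto simp: \<Gamma>_def)
    moreover have "closed {p :: (real^'n) \<times> (real^'n). fst p \<bullet> snd p = 1}"
      by (intro closed_Collect_eq continuous_intros)
    ultimately show ?thesis using comp by (simp add: compact_Int_closed)
  qed
  then have "compact \<Phi>"
    unfolding \<Phi>_def by (rule compact_continuous_image[rotated]) (intro continuous_intros continuous_on_outer)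
  then have hull: "compact (convex hull \<Phi>)" by (rule compact_convex_hull)
  have "((1 / ?n) *\<^sub>R mat 1, 0) \<in> convex hull \<Phi>"
  proof (rule ccontr)
    assume "\<not> ?thesis"
    then obtain a \<tau> where a: "a \<bullet> ((1 / ?n) *\<^sub>R mat 1, 0) < \<tau>" "\<And>v. v \<in> convex hull \<Phi> \<Longrightarrow> a \<bullet> v > \<tau>"
      using separating_hyperplane_closed_point[OF convex_convex_hull compact_imp_closed[OF hull]] by blast
    define B where "B = mat \<tau> - fst a"
    define b where "b = - snd a"
    define f where "f p = snd p \<bullet> (B *v fst p) + b \<bullet> snd p" for p
    have mat_tau: "mat \<tau> = \<tau> *\<^sub>R (mat 1 :: real^'n^'n)"
      by (simp add: mat_def vec_eq_iff)
    have f_neg: "f p < 0" if p: "p \<in> \<Gamma>" for p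
    proof -
      have "(outer (snd p) (fst p), snd p) \<in> convex hull \<Phi>"
        using p by (auto simp: \<Phi>_def intro: hull_inc)
      from a(2)[OF this] have "\<tau> < snd p \<bullet> (fst a *v fst p) + snd a \<bullet> snd p"
        by (simp add: inner_prod_def inner_outer)
      moreover have "snd p \<bullet> (mat \<tau> *v fst p) = \<tau>"
        using p by (simp add: \<Gamma>_def mat_tau scaleR_matrix_vector_assoc[symmetric] inner_commute)
      ultimately show ?thesis
        by (simp add: f_def B_def b_def matrix_vector_mult_diff_rdistrib inner_diff_right inner_commute)
    qed
    have "trace (fst a) < ?n * \<tau>"
      using a(1) n by (simp add: inner_prod_def inner_mat_1 pos_divide_less_eq mult.commute)
    moreover have "trace (mat \<tau> :: real^'n^'n) = ?n * \<tau>" by (simp add: trace_def mat_def)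
    ultimately have trB: "trace B > 0" by (simp add: B_def trace_sub)
    have contf: "continuous_on A f" for A
      unfolding f_def matrix_vector_mult_def by (intro continuous_intros continuous_on_vec_lambda)
    \<comment> \<open>pairs that the motion does not push inwards; they stay at a positive distance from contact\<close>
    define N where "N = (L \<times> polar K) \<inter> {p. f p \<ge> 0}"
    have "compact N"
      unfolding N_def by (intro compact_Int_closed comp closed_Collect_le contf continuous_intros)
    have N1: "fst p \<bullet> snd p < 1" if "p \<in> N" for p
    proof -
      have "fst p \<bullet> snd p \<le> 1" using that LK polarD[of "snd p" K "fst p"] by (auto simp: N_def)
      moreover have "fst p \<bullet> snd p \<noteq> 1" using that f_neg[of p] by (auto simp: N_def \<Gamma>_def)
      ultimately show ?thesis by simp
    qed
    obtain \<rho> where \<rho>: "\<rho> > 0" "\<And>p. p \<in> N \<Longrightarrow> fst p \<bullet> snd p \<le> 1 - \<rho>"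
    proof (cases "N = {}")
      case False
      have "continuous_on N (\<lambda>p. fst p \<bullet> snd p)" by (intro continuous_intros)
      then obtain q where "q \<in> N" "\<And>p. p \<in> N \<Longrightarrow> fst p \<bullet> snd p \<le> fst q \<bullet> snd q"
        using continuous_attains_sup[OF \<open>compact N\<close> False] by blast
      then show ?thesis using that[of "1 - fst q \<bullet> snd q"] N1[of q] by simp
    qed (use that[of 1] in auto)
    have "bounded (f ` (L \<times> polar K))"
      using compact_continuous_image[OF contf comp] by (rule compact_imp_bounded)
    then obtain F where F: "F > 0" "\<And>p. p \<in> L \<times> polar K \<Longrightarrow> \<bar>f p\<bar> \<le> F"
      by (auto simp: bounded_pos)
    obtain d where d: "d > 0" "\<And>h. 0 < h \<Longrightarrow> h < d \<Longrightarrow> det (mat 1 :: real^'n^'n) < det (mat 1 + h *\<^sub>R B)"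
      using DERIV_pos_inc_right[OF has_real_derivative_det_at_identity trB] by auto
    define h where "h = min (d / 2) (\<rho> / F)"
    have h: "0 < h" "h < d" "h * F \<le> \<rho>"
      using d(1) \<rho>(1) F(1) by (auto simp: h_def min_def field_simps)
    have "\<forall>x\<in>L. (mat 1 + h *\<^sub>R B) *v x + h *\<^sub>R b \<in> K"
    proof
      fix x assume x: "x \<in> L"
      show "(mat 1 + h *\<^sub>R B) *v x + h *\<^sub>R b \<in> K"
      proof (rule bipolar[OF K K0])
        fix u assume u: "u \<in> polar K"
        have eq: "((mat 1 + h *\<^sub>R B) *v x + h *\<^sub>R b) \<bullet> u = x \<bullet> u + h * f (x, u)"
          by (simp add: f_def matrix_vector_mult_add_rdistrib scaleR_matrix_vector_assoc[symmetric]
              inner_add_left inner_commute algebra_simps)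
        show "((mat 1 + h *\<^sub>R B) *v x + h *\<^sub>R b) \<bullet> u \<le> 1"
        proof (cases "f (x, u) \<ge> 0")
          case True
          then have "x \<bullet> u \<le> 1 - \<rho>" using \<rho>(2)[of "(x,u)"] x u by (simp add: N_def)
          moreover have "h * f (x, u) \<le> h * F"
            using F(2)[of "(x,u)"] x u h(1) by (intro mult_left_mono) auto
          ultimately show ?thesis using eq h(3) by simp
        next
          case False
          then have "h * f (x, u) \<le> 0" using h(1) by (simp add: mult_nonneg_nonpos)
          moreover have "x \<bullet> u \<le> 1" using polarD[OF u] x LK by blast
          ultimately show ?thesis using eq by simp
        qed
      qed
    qed
    from max[OF this] d(2)[OF h(1,2)] show False by simp
  qed
  then obtain I w where I: "finite I" "I \<subseteq> \<Phi>" "\<And>i. i \<in> I \<Longrightarrow> 0 \<le> w i" "sum w I = 1"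
    "(\<Sum>v\<in>I. w v *\<^sub>R v) = ((1 / ?n) *\<^sub>R mat 1, 0)"
    unfolding convex_hull_explicit by blast
  have "\<forall>i\<in>I. \<exists>p. p \<in> \<Gamma> \<and> i = (outer (snd p) (fst p), snd p)"
    using I(2) unfolding \<Phi>_def by blast
  then obtain g where g: "\<And>i. i \<in> I \<Longrightarrow> g i \<in> \<Gamma>" "\<And>i. i \<in> I \<Longrightarrow> i = (outer (snd (g i)) (fst (g i)), snd (g i))"
    by metis
  have gi: "outer (snd (g i)) (fst (g i)) = fst i" "snd (g i) = snd i" if "i \<in> I" for i
    using g(2)[OF that] by (metis fst_conv, metis snd_conv)
  have s1: "(\<Sum>i\<in>I. w i *\<^sub>R outer (snd (g i)) (fst (g i))) = (1 / ?n) *\<^sub>R mat 1"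
  proof -
    have "(\<Sum>i\<in>I. w i *\<^sub>R outer (snd (g i)) (fst (g i))) = (\<Sum>i\<in>I. fst (w i *\<^sub>R i))"
      by (rule sum.cong[OF refl]) (metis gi fst_scaleR snd_scaleR)
    also have "\<dots> = (1 / ?n) *\<^sub>R mat 1" by (simp add: fst_sum[symmetric] I(5) del: fst_scaleR)
    finally show ?thesis .
  qed
  have s2: "(\<Sum>i\<in>I. w i *\<^sub>R snd (g i)) = 0"
  proof -
    have "(\<Sum>i\<in>I. w i *\<^sub>R snd (g i)) = (\<Sum>i\<in>I. snd (w i *\<^sub>R i))"
      by (rule sum.cong[OF refl]) (metis gi fst_scaleR snd_scaleR)
    also have "\<dots> = 0" by (simp add: snd_sum[symmetric] I(5) del: snd_scaleR)
    finally show ?thesis .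
  qed
  have "contact_decomposition K L I (\<lambda>i. ?n * w i) (\<lambda>i. fst (g i)) (\<lambda>i. snd (g i)) ?n"
  proof
    show "?n * w i \<ge> 0" if "i \<in> I" for i using I(3)[OF that] by simp
    show "fst (g i) \<in> L" "snd (g i) \<in> polar K" "fst (g i) \<bullet> snd (g i) = 1" if "i \<in> I" for i
      using g(1)[OF that] by (auto simp: \<Gamma>_def)
    show "(\<Sum>i\<in>I. ?n * w i) = ?n" using I(4) by (simp add: sum_distrib_left[symmetric])
    show "?n = DIM(real^'n)" by simp
    show "(\<Sum>i\<in>I. (?n * w i) *\<^sub>R snd (g i)) = 0"
      using s2 by (simp add: scaleR_scaleR[symmetric] scaleR_sum_right[symmetric] del: scaleR_scaleR)
    fix a :: "real^'n"
    have lin: "linear (\<lambda>M :: real^'n^'n. a v* M)"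
      by (rule linearI) (simp_all add: vector_matrix_mult_def vec_eq_iff sum.distrib algebra_simps sum_distrib_left)
    have out: "a v* outer u x = (a \<bullet> u) *\<^sub>R x" for u x
      by (simp add: outer_def vector_matrix_mult_def vec_eq_iff inner_vec_def sum_distrib_left sum_distrib_right algebra_simps)
    have "(1 / ?n) *\<^sub>R a = a v* ((1 / ?n) *\<^sub>R mat 1)"
      by (simp add: linear_scale[OF lin])
    also have "\<dots> = (\<Sum>i\<in>I. w i *\<^sub>R ((a \<bullet> snd (g i)) *\<^sub>R fst (g i)))"
      unfolding s1[symmetric] linear_sum[OF lin] by (simp add: linear_scale[OF lin] out)
    finally have "?n *\<^sub>R ((1 / ?n) *\<^sub>R a) = ?n *\<^sub>R (\<Sum>i\<in>I. w i *\<^sub>R ((a \<bullet> snd (g i)) *\<^sub>R fst (g i)))" by simp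
    then show "(\<Sum>i\<in>I. (?n * w i * (a \<bullet> snd (g i))) *\<^sub>R fst (g i)) = a"
      by (simp add: scaleR_sum_right mult.assoc)
  qed (use L LK I(1) in auto)
  then show ?thesis by blast
qed

text \<open>The admissible pairs \<open>(M, b)\<close> form a compact set: \<open>b\<close> lies in \<open>K\<close>, and the columns of \<open>M\<close> are bounded because \<open>L\<close> contains a
ball.  A small homothetic copy of \<open>L\<close> shows that the maximum is positive.\<close>

lemma maximal_affine_image:
  fixes K L :: "(real^'n) set"
  assumes L: "compact L" "0 \<in> interior L" and K: "compact K" "interior K \<noteq> {}"
  obtains M b where "det M > 0" "\<And>x. x \<in> L \<Longrightarrow> M *v x + b \<in> K"
    "\<And>N d. (\<forall>x\<in>L. N *v x + d \<in> K) \<Longrightarrow> det N \<le> det M"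
proof -
  define Z where "Z = {(M :: real^'n^'n, b). \<forall>x\<in>L. M *v x + b \<in> K}"
  have L0: "0 \<in> L" using L(2) interior_subset by blast
  obtain R where R: "R > 0" "\<And>x. x \<in> K \<Longrightarrow> norm x \<le> R"
    using compact_imp_bounded[OF K(1)] by (auto simp: bounded_pos)
  obtain Q where Q: "Q > 0" "\<And>x. x \<in> L \<Longrightarrow> norm x \<le> Q"
    using compact_imp_bounded[OF L(1)] by (auto simp: bounded_pos)
  obtain r where r: "r > 0" "cball 0 r \<subseteq> L" using L(2) by (meson mem_interior_cball)
  obtain b0 \<rho> where \<rho>: "\<rho> > 0" "cball b0 \<rho> \<subseteq> K" using K(2) by (metis ex_in_conv mem_interior_cball)
  have "closed Z"
  proof -
    have "Z = (\<Inter>x\<in>L. {p. fst p *v x + snd p \<in> K})" by (auto simp: Z_def)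
    moreover have "closed {p :: (real^'n^'n) \<times> (real^'n). fst p *v x + snd p \<in> K}" for x
    proof -
      have "continuous_on UNIV (\<lambda>p :: (real^'n^'n) \<times> (real^'n). fst p *v x + snd p)"
        unfolding matrix_vector_mult_def by (intro continuous_intros continuous_on_vec_lambda)
      then show ?thesis
        using closed_vimage[OF compact_imp_closed[OF K(1)]] by (simp add: vimage_def)
    qed
    ultimately show ?thesis by (simp add: closed_INT)
  qed
  moreover have "bounded Z"
  proof -
    have ent: "\<bar>M $ i $ j\<bar> \<le> 2 * R / r" if "(M, b) \<in> Z" for M b i j
    proof -
      have "r *\<^sub>R axis j 1 \<in> L" using r by (intro subsetD[OF r(2)]) (simp add: norm_axis_1)
      then have "M *v (r *\<^sub>R axis j 1) + b \<in> K" "M *v 0 + b \<in> K" using that L0 by (auto simp: Z_def)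
      then have "norm (M *v (r *\<^sub>R axis j 1)) \<le> 2 * R"
        using R(2)[of "M *v (r *\<^sub>R axis j 1) + b"] R(2)[of b] norm_triangle_ineq4[of "M *v (r *\<^sub>R axis j 1) + b" b] by simp
      then have "r * norm (column j M) \<le> 2 * R"
        using r(1) by (simp add: matrix_vector_mult_scaleR matrix_vector_mul_component matrix_vector_mult_basis)
      moreover have "\<bar>M $ i $ j\<bar> \<le> norm (column j M)" using component_le_norm_cart[of "column j M" i] by (simp add: column_def)
      ultimately have "r * \<bar>M $ i $ j\<bar> \<le> 2 * R" using r(1) by (smt (verit) mult_left_mono)
      then show ?thesis using r(1) by (simp add: field_simps)
    qed
    have nrm: "norm M \<le> (\<Sum>i\<in>(UNIV::'n set). \<Sum>j\<in>(UNIV::'n set). 2 * R / r)" if "(M, b) \<in> Z" for M b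
    proof -
      have "norm M \<le> (\<Sum>i\<in>UNIV. norm (M $ i))" unfolding norm_vec_def by (rule L2_set_le_sum) simp
      also have "\<dots> \<le> (\<Sum>i\<in>UNIV. \<Sum>j\<in>UNIV. \<bar>M $ i $ j\<bar>)" by (intro sum_mono norm_le_l1_cart)
      also have "\<dots> \<le> (\<Sum>i\<in>(UNIV::'n set). \<Sum>j\<in>(UNIV::'n set). 2 * R / r)" by (intro sum_mono ent[OF that])
      finally show ?thesis .
    qed
    have "Z \<subseteq> cball 0 (\<Sum>i\<in>(UNIV::'n set). \<Sum>j\<in>(UNIV::'n set). 2 * R / r) \<times> K"
      using nrm L0 by (fastforce simp: Z_def)
    then show ?thesis using bounded_Times[OF bounded_cball compact_imp_bounded[OF K(1)]] bounded_subset by blast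
  qed
  ultimately have "compact Z" by (simp add: compact_eq_bounded_closed)
  define t where "t = \<rho> / Q"
  have t: "t > 0" using \<rho> Q by (simp add: t_def)
  have tZ: "(mat t, b0) \<in> Z"
  proof -
    have "mat t *v x + b0 \<in> K" if "x \<in> L" for x
    proof (rule subsetD[OF \<rho>(2)])
      have "mat t *v x = t *\<^sub>R x"
        by (simp add: mat_def matrix_vector_mult_def vec_eq_iff if_distrib if_distribR cong: if_cong)
      moreover have "norm (t *\<^sub>R x) \<le> \<rho>"
        using Q(2)[OF that] Q(1) \<rho>(1) by (simp add: t_def field_simps)
      ultimately show "mat t *v x + b0 \<in> cball b0 \<rho>" by (simp add: dist_norm)
    qed
    then show ?thesis by (simp add: Z_def)
  qed
  have dt: "det (mat t :: real^'n^'n) > 0"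
    using t by (subst det_diagonal) (auto simp: mat_def)
  have "continuous_on Z (\<lambda>p. det (fst p))"
    by (rule continuous_on_compose2[OF continuous_on_det[of UNIV]]) (auto intro: continuous_intros)
  then obtain p where p: "p \<in> Z" "\<And>q. q \<in> Z \<Longrightarrow> det (fst q) \<le> det (fst p)"
    using continuous_attains_sup[OF \<open>compact Z\<close>] tZ by blast
  show thesis
    by (rule that[of "fst p" "snd p"]) (use p dt p(2)[OF tZ] in \<open>auto simp: Z_def\<close>)
qed

section \<open>Smoothness of the unit balls of p-norms\<close>

lemma has_real_derivative_abs_powr:
  fixes x q :: real
  assumes q: "q > 1"
  shows "((\<lambda>x. \<bar>x\<bar> powr q) has_real_derivative q * sgn x * \<bar>x\<bar> powr (q - 1)) (at x)"
proof (cases x "0 :: real" rule: linorder_cases)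
  case equal
  have "((\<lambda>h::real. \<bar>h\<bar> powr (q - 1)) \<longlongrightarrow> 0) (at 0)"
    using q by (intro tendsto_zero_powrI tendsto_rabs_zero tendsto_ident_at tendsto_const) auto
  then have "((\<lambda>h::real. (\<bar>0 + h\<bar> powr q - \<bar>0\<bar> powr q) / h) \<longlongrightarrow> 0) (at 0)"
  proof (rule Lim_null_comparison[rotated])
    show "\<forall>\<^sub>F h in at 0. norm ((\<bar>0 + h\<bar> powr q - \<bar>0\<bar> powr q) / h) \<le> \<bar>h\<bar> powr (q - 1)"
      unfolding eventually_at_filter by (rule always_eventually) (auto simp: powr_diff)
  qed
  then show ?thesis using equal by (simp add: DERIV_def)
next
  case greater
  have "((\<lambda>x. x powr q) has_real_derivative q * x powr (q - 1)) (at x)"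
    using greater by (auto intro!: derivative_eq_intros)
  then have "((\<lambda>x. \<bar>x\<bar> powr q) has_real_derivative q * x powr (q - 1)) (at x)"
    by (rule has_field_derivative_transform_within_open[where S = "{0<..}"]) (use greater in auto)
  then show ?thesis using greater by simp
next
  case less
  have "((\<lambda>x. (- x) powr q) has_real_derivative - (q * (- x) powr (q - 1))) (at x)"
    using less by (auto intro!: derivative_eq_intros)
  then have "((\<lambda>x. \<bar>x\<bar> powr q) has_real_derivative - (q * (- x) powr (q - 1))) (at x)"
    by (rule has_field_derivative_transform_within_open[where S = "{..<0}"]) (use less in auto)
  then show ?thesis using less by simp
qed

text \<open>Odd extension preserves monotonicity.  It is used for the derivatives of even functions.\<close>

lemma sgn_mult_mono:
  fixes g :: "real \<Rightarrow> real"
  assumes g: "g 0 = 0" "\<And>s t. 0 \<le> s \<Longrightarrow> s \<le> t \<Longrightarrow> t \<le> r \<Longrightarrow> g s \<le> g t"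
    and xy: "\<bar>x\<bar> \<le> r" "\<bar>y\<bar> \<le> r" "x \<le> y"
  shows "sgn x * g \<bar>x\<bar> \<le> sgn y * g \<bar>y\<bar>"
proof -
  have nn: "0 \<le> g t" if "0 \<le> t" "t \<le> r" for t using g(2)[of 0 t] g(1) that by simp
  consider "x \<ge> 0" | "y \<le> 0" | "x < 0" "0 < y" by linarith
  then show ?thesis
  proof cases
    case 1 
    then show ?thesis using xy g(2)[of x y] nn[of y] by (auto simp: sgn_real_def)
  next
    case 2
    then show ?thesis using xy g(2)[of "- y" "- x"] nn[of "- x"] by (auto simp: sgn_real_def)
  next
    case 3
    then show ?thesis using xy nn[of "- x"] nn[of y] by (auto simp: sgn_real_def)
  qed
qed

lemma convex_on_abs_powr:
  assumes "p \<ge> (1::real)"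
  shows "convex_on UNIV (\<lambda>x::real. \<bar>x\<bar> powr p)"
proof (cases "p = 1")
  case True
  have "\<bar>(1 - t) * x + t * y\<bar> \<le> (1 - t) * \<bar>x\<bar> + t * \<bar>y\<bar>" if "0 < t" "t < 1" for t x y :: real
    using abs_triangle_ineq[of "(1 - t) * x" "t * y"] that by (simp add: abs_mult)
  then show ?thesis using True by (intro convex_onI) auto
next
  case False
  then have p: "p > 1" using assms by simp
  show ?thesis
  proof (rule convex_on_realI)
    show "((\<lambda>x. \<bar>x\<bar> powr p) has_real_derivative p * sgn x * \<bar>x\<bar> powr (p - 1)) (at x)" for x :: real
      by (rule has_real_derivative_abs_powr[OF p])
    show "p * sgn x * \<bar>x\<bar> powr (p - 1) \<le> p * sgn y * \<bar>y\<bar> powr (p - 1)" if "x \<le> y" for x y :: real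
      unfolding mult.assoc using p that
      by (intro mult_left_mono sgn_mult_mono[where g = "\<lambda>t. t powr (p - 1)" and r = "max \<bar>x\<bar> \<bar>y\<bar>"])
         (auto intro: powr_mono2)
  qed auto
qed

text \<open>On \<open>[-1, 1]\<close> the second derivative of \<open>\<bar>x\<bar> powr q\<close> is at least \<open>q (q - 1)\<close>, so subtracting \<open>q (q - 1) / 2 * x\<^sup>2\<close> leaves a
convex function.  As the second derivative is singular at \<open>0\<close>, convexity is checked through monotonicity of the first
derivative.\<close>

lemma abs_powr_midpoint_strong:
  fixes a b q :: real
  assumes q: "1 < q" "q \<le> 2" and ab: "\<bar>a\<bar> \<le> 1" "\<bar>b\<bar> \<le> 1"
  shows "\<bar>(a + b) / 2\<bar> powr q \<le> (\<bar>a\<bar> powr q + \<bar>b\<bar> powr q) / 2 - q * (q - 1) / 8 * (a - b)\<^sup>2"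
proof -
  define f where "f x = \<bar>x\<bar> powr q - q * (q - 1) / 2 * x\<^sup>2" for x :: real
  define g where "g t = t powr (q - 1) - (q - 1) * t" for t :: real
  have g_mono: "g s \<le> g t" if st: "0 \<le> s" "s \<le> t" "t \<le> 1" for s t
  proof (cases "s = 0")
    case True
    have "(q - 1) * t \<le> 1 * t" using q st by (intro mult_right_mono) auto
    also have "1 * t = t powr 1" using st by simp
    also have "\<dots> \<le> t powr (q - 1)" using q st by (intro powr_mono') auto
    finally show ?thesis using True by (simp add: g_def)
  next
    case False
    show ?thesis
    proof (rule DERIV_nonneg_imp_nondecreasing[OF st(2)], intro exI conjI)
      fix x assume x: "s \<le> x" "x \<le> t"
      then show "(g has_real_derivative (q - 1) * x powr (q - 1 - 1) - (q - 1)) (at x)"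
        unfolding g_def using st False by (auto intro!: derivative_eq_intros)
      have "x powr 0 \<le> x powr (q - 1 - 1)" using q x st False by (intro powr_mono') auto
      then have "(q - 1) * 1 \<le> (q - 1) * x powr (q - 1 - 1)" using x st False q by (intro mult_left_mono) auto
      then show "0 \<le> (q - 1) * x powr (q - 1 - 1) - (q - 1)" by simp
    qed
  qed
  have "convex_on {-1..1} f"
  proof (rule convex_on_realI)
    show "(f has_real_derivative q * (sgn x * g \<bar>x\<bar>)) (at x)" for x
    proof -
      have "(f has_real_derivative q * sgn x * \<bar>x\<bar> powr (q - 1) - q * (q - 1) / 2 * (2 * x)) (at x)"
        unfolding f_def by (rule derivative_eq_intros has_real_derivative_abs_powr[OF q(1)] refl | simp)+
      moreover have "q * sgn x * \<bar>x\<bar> powr (q - 1) - q * (q - 1) / 2 * (2 * x) = q * (sgn x * g \<bar>x\<bar>)"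
      proof -
        have "\<bar>x\<bar> * sgn x = x" by (simp add: abs_mult_sgn)
        moreover have "q * (sgn x * g \<bar>x\<bar>) = q * sgn x * \<bar>x\<bar> powr (q - 1) - q * (q - 1) * (\<bar>x\<bar> * sgn x)"
          by (simp add: g_def algebra_simps)
        ultimately show ?thesis by simp
      qed
      ultimately show ?thesis by simp
    qed
    show "q * (sgn x * g \<bar>x\<bar>) \<le> q * (sgn y * g \<bar>y\<bar>)" if "x \<in> {-1..1}" "y \<in> {-1..1}" "x \<le> y" for x y
      using that q by (intro mult_left_mono sgn_mult_mono[where r = 1] g_mono) (auto simp: g_def)
  qed auto
  from convex_onD[OF this, of "1/2" a b] have "f ((a + b) / 2) \<le> (f a + f b) / 2"
    using ab by (simp add: field_simps abs_le_iff)
  moreover have "((a + b) / 2)\<^sup>2 = (a\<^sup>2 + b\<^sup>2) / 2 - (a - b)\<^sup>2 / 4" by (simp add: power2_eq_square field_simps)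
  moreover have "M \<le> (A + B) / 2 - k / 4 * d"
    if "M - k * m2 \<le> ((A - k * a2) + (B - k * b2)) / 2" "m2 = (a2 + b2) / 2 - d / 4" for M A B k m2 a2 b2 d :: real
    using that(1) unfolding that(2) by (simp add: field_simps)
  ultimately have "\<bar>(a + b) / 2\<bar> powr q \<le> (\<bar>a\<bar> powr q + \<bar>b\<bar> powr q) / 2 - q * (q - 1) / 2 / 4 * (a - b)\<^sup>2"
    unfolding f_def by blast
  then show ?thesis by simp
qed

lemma powr_superadditive:
  fixes u v r :: real
  assumes "u \<ge> 0" "v \<ge> 0" "r \<ge> 1"
  shows "u powr r + v powr r \<le> (u + v) powr r"
proof -
  have split: "t powr r = t * t powr (r - 1)" if "t \<ge> 0" for t
    using that assms(3) by (cases "t = 0") (auto simp: powr_mult_base)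
  have "u * u powr (r - 1) + v * v powr (r - 1) \<le> u * (u + v) powr (r - 1) + v * (u + v) powr (r - 1)"
    using assms by (intro add_mono mult_left_mono powr_mono2) auto
  also have "\<dots> = (u + v) powr r"
    using assms by (simp add: split[of "u + v"] distrib_right)
  finally show ?thesis using assms by (simp add: split)
qed

text \<open>Put \<open>r = q / 2 \<ge> 1\<close>.  The squares of \<open>(a + b) / 2\<close> and \<open>(a - b) / 2\<close> add up to the mean of \<open>a\<^sup>2\<close> and \<open>b\<^sup>2\<close>; superadditivity
of \<open>t powr r\<close> bounds the left-hand side and its convexity gives the right-hand side.\<close>

lemma clarkson_scalar:
  fixes a b q :: real
  assumes q: "q \<ge> 2"
  shows "\<bar>(a + b) / 2\<bar> powr q + \<bar>(a - b) / 2\<bar> powr q \<le> (\<bar>a\<bar> powr q + \<bar>b\<bar> powr q) / 2"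
proof -
  have sq: "\<bar>s\<bar> powr q = (s\<^sup>2) powr (q / 2)" for s :: real
  proof -
    have sq2: "\<bar>s\<bar> powr 2 = s\<^sup>2" by (simp add: powr_numeral)
    have "(\<bar>s\<bar> powr 2) powr (q / 2) = \<bar>s\<bar> powr q" unfolding powr_powr by simp
    then show ?thesis unfolding sq2 by (rule sym)
  qed
  have "((a + b) / 2)\<^sup>2 powr (q / 2) + ((a - b) / 2)\<^sup>2 powr (q / 2) \<le> (((a + b) / 2)\<^sup>2 + ((a - b) / 2)\<^sup>2) powr (q / 2)"
    using q by (intro powr_superadditive) auto
  also have "((a + b) / 2)\<^sup>2 + ((a - b) / 2)\<^sup>2 = (1 - 1/2) *\<^sub>R a\<^sup>2 + (1/2) *\<^sub>R b\<^sup>2"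
    by (simp add: power2_eq_square field_simps)
  also have "\<dots> powr (q / 2) = \<bar>(1 - 1/2) *\<^sub>R a\<^sup>2 + (1/2) *\<^sub>R b\<^sup>2\<bar> powr (q / 2)" by simp
  also have "\<dots> \<le> (1 - 1/2) * \<bar>a\<^sup>2\<bar> powr (q / 2) + (1/2) * \<bar>b\<^sup>2\<bar> powr (q / 2)"
    using q by (intro convex_onD[OF convex_on_abs_powr]) auto
  finally show ?thesis unfolding sq by (simp add: add_divide_distrib)
qed

definition power_sum :: "real \<Rightarrow> real^'n \<Rightarrow> real" where
  "power_sum p v = (\<Sum>i\<in>UNIV. \<bar>v $ i\<bar> powr p)"

lemma lp_ball_iff: "v \<in> lp_ball p \<longleftrightarrow> power_sum p v \<le> 1"
  by (simp add: lp_ball_def power_sum_def)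

lemma abs_component_le_1: 
  assumes "power_sum p v \<le> 1" "p > 0" 
  shows "\<bar>v $ i\<bar> \<le> 1"
proof (rule ccontr)
  assume "\<not> ?thesis"
  then have "\<bar>v $ i\<bar> powr p > 1" using assms(2) by (simp add: gr_one_powr)
  moreover have "\<bar>v $ i\<bar> powr p \<le> power_sum p v" unfolding power_sum_def by (intro member_le_sum) auto
  ultimately show False using assms(1) by simp
qed

lemma inner_le_power_sums:
  assumes "p > 1" "q > 1" "1 / p + 1 / q = 1"
  shows "v \<bullet> u \<le> power_sum p v / p + power_sum q u / q"
proof -
  have "v \<bullet> u \<le> (\<Sum>i\<in>UNIV. \<bar>v $ i\<bar> * \<bar>u $ i\<bar>)"
    unfolding inner_vec_def by (intro sum_mono) (simp flip: abs_mult)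
  also have "\<dots> \<le> (\<Sum>i\<in>UNIV. \<bar>v $ i\<bar> powr p / p + \<bar>u $ i\<bar> powr q / q)"
    using assms by (intro sum_mono Youngs_inequality) auto
  finally show ?thesis by (simp add: power_sum_def sum.distrib sum_divide_distrib)
qed

text \<open>The vector \<open>v\<close> is the equality case of Hoelder's inequality for \<open>u\<close>, normalised to lie on the unit sphere.\<close>

lemma polar_lp_ball:
  assumes pq: "p > 1" "q > 1" "1 / p + 1 / q = 1" and u: "u \<in> polar (lp_ball p)"
  shows "power_sum q u \<le> 1"
proof (rule ccontr)
  assume neg: "\<not> ?thesis"
  define F where "F = power_sum q u"
  have F: "F > 1" using neg by (simp add: F_def)
  have pq': "(q - 1) * p = q" using pq by (simp add: field_simps)
  define v where "v = (\<chi> i. F powr (- 1 / p) * (sgn (u $ i) * \<bar>u $ i\<bar> powr (q - 1)))"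
  have "power_sum p v = (\<Sum>i\<in>UNIV. (1 / F) * \<bar>u $ i\<bar> powr q)"
    unfolding power_sum_def
  proof (rule sum.cong[OF refl])
    fix i
    have "\<bar>v $ i\<bar> = F powr (- 1 / p) * \<bar>u $ i\<bar> powr (q - 1)"
      by (simp add: v_def abs_mult abs_sgn_eq)
    then have "\<bar>v $ i\<bar> powr p = F powr (- 1) * \<bar>u $ i\<bar> powr q"
      using pq by (simp add: powr_mult powr_powr pq')
    then show "\<bar>v $ i\<bar> powr p = (1 / F) * \<bar>u $ i\<bar> powr q" using F by (simp add: powr_minus_divide)
  qed
  also have "\<dots> = 1" using F unfolding sum_distrib_left[symmetric] by (simp add: F_def power_sum_def)
  finally have "v \<in> lp_ball p" by (simp add: lp_ball_iff)
  then have "v \<bullet> u \<le> 1" by (rule polarD[OF u])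
  moreover have "v \<bullet> u = F powr (- 1 / p) * F"
  proof -
    have "v \<bullet> u = (\<Sum>i\<in>UNIV. F powr (- 1 / p) * \<bar>u $ i\<bar> powr q)"
      unfolding inner_vec_def
    proof (rule sum.cong[OF refl])
      fix i
      have "sgn (u $ i) * \<bar>u $ i\<bar> powr (q - 1) * u $ i = \<bar>u $ i\<bar> * \<bar>u $ i\<bar> powr (q - 1)"
        by (simp add: abs_sgn mult_ac)
      also have "\<dots> = \<bar>u $ i\<bar> powr q" by (cases "u $ i = 0") (simp_all add: powr_mult_base)
      finally show "v $ i \<bullet> u $ i = F powr (- 1 / p) * \<bar>u $ i\<bar> powr q" by (simp add: v_def mult.assoc)
    qed
    then show ?thesis by (simp add: F_def power_sum_def sum_distrib_left)
  qed
  moreover have "F powr (- 1 / p) * F > 1"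
  proof -
    have "F powr (- 1 / p) * F = F powr (- 1 / p + 1)" using F powr_add[of F "- 1 / p" 1] by simp
    also have "- 1 / p + 1 = 1 / q" using pq(3) by simp
    finally show ?thesis using F pq by (simp add: gr_one_powr)
  qed
  ultimately show False by simp
qed

lemma convex_lp_ball: assumes "p \<ge> 1" shows "convex (lp_ball p :: (real^'n) set)"
proof (rule convexI)
  fix v w :: "real^'n" and s t :: real
  assume vw: "v \<in> lp_ball p" "w \<in> lp_ball p" and st: "s \<ge> 0" "t \<ge> 0" "s + t = 1"
  have s: "s = 1 - t" using st by simp
  have "power_sum p (s *\<^sub>R v + t *\<^sub>R w) \<le> (\<Sum>i\<in>UNIV. s * \<bar>v $ i\<bar> powr p + t * \<bar>w $ i\<bar> powr p)"
    unfolding power_sum_def s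
    using convex_onD[OF convex_on_abs_powr[OF assms], of t] st by (intro sum_mono) auto
  also have "\<dots> = s * power_sum p v + t * power_sum p w"
    by (simp add: power_sum_def sum.distrib sum_distrib_left)
  also have "\<dots> \<le> s * 1 + t * 1" using vw st by (intro add_mono mult_left_mono) (auto simp: lp_ball_iff)
  finally show "s *\<^sub>R v + t *\<^sub>R w \<in> lp_ball p" using st by (simp add: lp_ball_iff)
qed

lemma compact_lp_ball: assumes "p > 0" shows "compact (lp_ball p :: (real^'n) set)"
proof -
  have "norm v \<le> CARD('n)" if "v \<in> lp_ball p" for v :: "real^'n"
  proof -
    have "norm v \<le> (\<Sum>i\<in>UNIV. \<bar>v $ i\<bar>)" by (rule norm_le_l1_cart)
    also have "\<dots> \<le> (\<Sum>i\<in>(UNIV :: 'n set). 1)"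
      using that assms by (intro sum_mono abs_component_le_1) (auto simp: lp_ball_iff)
    finally show ?thesis by simp
  qed
  then have "bounded (lp_ball p :: (real^'n) set)" by (auto simp: bounded_iff)
  moreover have "closed (lp_ball p :: (real^'n) set)"
    unfolding lp_ball_def using assms
    by (intro closed_Collect_le continuous_intros continuous_on_powr') auto
  ultimately show ?thesis by (simp add: compact_eq_bounded_closed)
qed

lemma zero_in_interior_lp_ball: assumes "p \<ge> 1" shows "0 \<in> interior (lp_ball p :: (real^'n) set)"
proof -
  have "cball 0 (1 / CARD('n)) \<subseteq> (lp_ball p :: (real^'n) set)"
  proof
    fix v :: "real^'n" assume v: "v \<in> cball 0 (1 / CARD('n))"
    have "power_sum p v \<le> (\<Sum>i\<in>(UNIV :: 'n set). 1 / CARD('n))"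
      unfolding power_sum_def
    proof (rule sum_mono)
      fix i
      have vi: "\<bar>v $ i\<bar> \<le> 1 / CARD('n)" using v component_le_norm_cart[of v i] by simp
      have "1 / real CARD('n) \<le> 1" by (simp add: Suc_leI divide_le_eq_1)
      then have "\<bar>v $ i\<bar> \<le> 1" using vi by linarith
      then have "\<bar>v $ i\<bar> powr p \<le> \<bar>v $ i\<bar> powr 1" using assms by (intro powr_mono') auto
      then show "\<bar>v $ i\<bar> powr p \<le> 1 / CARD('n)" using vi by simp
    qed
    then show "v \<in> lp_ball p" by (simp add: lp_ball_iff)
  qed
  then show ?thesis by (meson mem_interior_cball zero_less_divide_1_iff of_nat_0_less_iff zero_less_card_finite)
qed

lemma uminus_lp_ball: "v \<in> lp_ball p \<Longrightarrow> - v \<in> lp_ball p"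
  by (simp add: lp_ball_def)

text \<open>If \<open>y\<close> and \<open>u\<close> both almost attain \<open>1\<close> at the unit vector \<open>x\<close>, so does their midpoint, and Young's inequality
bounds its power sum from below.  Uniform convexity of the dual norm then forces \<open>y\<close> and \<open>u\<close> together.\<close>

lemma power_sum_midpoint_ge:
  assumes pq: "p > 1" "q > 1" "1 / p + 1 / q = 1"
    and x: "x \<in> lp_ball p" and "x \<bullet> y = 1" "x \<bullet> u \<ge> 1 - \<beta>"
  shows "power_sum q ((1/2) *\<^sub>R (y + u)) \<ge> 1 - q * \<beta> / 2"
proof -
  have "1 - \<beta> / 2 \<le> x \<bullet> ((1/2) *\<^sub>R (y + u))" using assms(5,6) by (simp add: inner_add_right)
  also have "\<dots> \<le> power_sum p x / p + power_sum q ((1/2) *\<^sub>R (y + u)) / q"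
    by (rule inner_le_power_sums[OF pq])
  also have "\<dots> \<le> 1 / p + power_sum q ((1/2) *\<^sub>R (y + u)) / q"
    using x pq by (intro add_mono divide_right_mono) (auto simp: lp_ball_iff)
  finally have "1 / q - \<beta> / 2 \<le> power_sum q ((1/2) *\<^sub>R (y + u)) / q" using pq(3) by linarith
  then have "q * (1 / q - \<beta> / 2) \<le> q * (power_sum q ((1/2) *\<^sub>R (y + u)) / q)"
    using pq by (intro mult_left_mono) auto
  then show ?thesis using pq by (simp add: right_diff_distrib)
qed

text \<open>Here the dual exponent is at most \<open>2\<close>, and strong convexity controls the Euclidean norm of \<open>y - u\<close>.  The factor \<open>CARD('n)\<close>
bounds the squared Euclidean norm of a vector of the ball.\<close>

lemma smooth_lp_ball_ge_2:
  fixes p \<phi> \<beta> :: real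
  assumes p: "p \<ge> 2" and \<phi>: "\<phi> \<ge> 0" "4 * real CARD('n) * (p - 1) * \<beta> \<le> \<phi>\<^sup>2"
  shows "smooth_with (lp_ball p :: (real^'n) set) \<beta> \<phi>"
  unfolding smooth_with_def
proof (intro ballI impI)
  fix x y u w :: "real^'n"
  assume x: "x \<in> lp_ball p" and y: "y \<in> polar (lp_ball p)" and u: "u \<in> polar (lp_ball p)"
    and xy: "x \<bullet> y = 1" and xu: "1 - \<beta> \<le> x \<bullet> u" and w: "w \<in> lp_ball p"
  define q where "q = p / (p - 1)"
  have pq: "p > 1" "q > 1" "1 / p + 1 / q = 1" and q2: "q \<le> 2" and q1: "q - 1 = 1 / (p - 1)"
    using p by (auto simp: q_def field_simps)
  have Fy: "power_sum q y \<le> 1" and Fu: "power_sum q u \<le> 1"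
    using polar_lp_ball[OF pq] y u by blast+
  have "power_sum q ((1/2) *\<^sub>R (y + u)) \<le> (\<Sum>i\<in>UNIV. (\<bar>y $ i\<bar> powr q + \<bar>u $ i\<bar> powr q) / 2 - q * (q - 1) / 8 * (y $ i - u $ i)\<^sup>2)"
    unfolding power_sum_def
  proof (rule sum_mono)
    fix i
    show "\<bar>((1/2) *\<^sub>R (y + u)) $ i\<bar> powr q \<le> (\<bar>y $ i\<bar> powr q + \<bar>u $ i\<bar> powr q) / 2 - q * (q - 1) / 8 * (y $ i - u $ i)\<^sup>2"
      using abs_powr_midpoint_strong[of q "y $ i" "u $ i"] pq q2 abs_component_le_1[OF Fy] abs_component_le_1[OF Fu] by simp
  qed
  also have "\<dots> = (power_sum q y + power_sum q u) / 2 - q * (q - 1) / 8 * (norm (y - u))\<^sup>2"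
  proof -
    have "(norm (y - u))\<^sup>2 = (\<Sum>i\<in>UNIV. (y $ i - u $ i)\<^sup>2)"
      unfolding power2_norm_eq_inner by (simp add: inner_vec_def power2_eq_square)
    then show ?thesis
      by (simp add: power_sum_def sum_subtractf sum.distrib[symmetric] sum_divide_distrib sum_distrib_left)
  qed
  also have "\<dots> \<le> 1 - q * (q - 1) / 8 * (norm (y - u))\<^sup>2" using Fy Fu by (intro diff_right_mono) simp
  finally have "power_sum q ((1/2) *\<^sub>R (y + u)) \<le> 1 - q * (q - 1) / 8 * (norm (y - u))\<^sup>2" .
  moreover have "a \<le> b" if "P \<le> 1 - a" "1 - b \<le> P" for a b P :: real
    using that by linarith
  ultimately have "q * (q - 1) / 8 * (norm (y - u))\<^sup>2 \<le> q * \<beta> / 2"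
    using power_sum_midpoint_ge[OF pq x xy xu] by blast
  then have "q * ((q - 1) / 8 * (norm (y - u))\<^sup>2) \<le> q * (\<beta> / 2)" by (simp add: mult.assoc)
  then have "(q - 1) / 8 * (norm (y - u))\<^sup>2 \<le> \<beta> / 2" using pq by simp
  then have d: "(norm (y - u))\<^sup>2 \<le> 4 * (p - 1) * \<beta>" using p unfolding q1 by (simp add: field_simps)
  have "(norm w)\<^sup>2 \<le> (\<Sum>i\<in>(UNIV :: 'n set). 1)"
    unfolding power2_norm_eq_inner inner_vec_def
  proof (rule sum_mono)
    fix i
    have "\<bar>w $ i\<bar> \<le> 1" using w p by (intro abs_component_le_1[of p]) (auto simp: lp_ball_iff)
    then show "w $ i \<bullet> w $ i \<le> 1" using abs_square_le_1[of "w $ i"] by (simp add: power2_eq_square)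
  qed
  then have "(norm w)\<^sup>2 \<le> CARD('n)" by simp
  then have "(norm w)\<^sup>2 * (norm (y - u))\<^sup>2 \<le> CARD('n) * (4 * (p - 1) * \<beta>)" using d by (intro mult_mono) auto
  also have "\<dots> \<le> \<phi>\<^sup>2" using \<phi>(2) by (simp add: algebra_simps)
  finally have "(norm w * norm (y - u))\<^sup>2 \<le> \<phi>\<^sup>2" by (simp add: power_mult_distrib)
  then have "norm w * norm (y - u) \<le> \<phi>" using \<phi>(1) by (rule power2_le_imp_le)
  then show "\<bar>w \<bullet> (y - u)\<bar> \<le> \<phi>" using Cauchy_Schwarz_ineq2[of w "y - u"] by linarith
qed

text \<open>Here the dual exponent is at least \<open>2\<close>, and Clarkson's inequality controls the dual norm of \<open>y - u\<close> directly.\<close>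

lemma smooth_lp_ball_le_2:
  fixes p q \<phi> \<beta> :: real
  assumes p: "1 < p" "p \<le> 2" and q: "q = p / (p - 1)" and \<phi>: "\<phi> > 0" "q * \<beta> / 2 \<le> (\<phi> / 2) powr q"
  shows "smooth_with (lp_ball p :: (real^'n) set) \<beta> \<phi>"
  unfolding smooth_with_def
proof (intro ballI impI)
  fix x y u w :: "real^'n"
  assume x: "x \<in> lp_ball p" and y: "y \<in> polar (lp_ball p)" and u: "u \<in> polar (lp_ball p)"
    and xy: "x \<bullet> y = 1" and xu: "1 - \<beta> \<le> x \<bullet> u" and w: "w \<in> lp_ball p"
  have pq: "p > 1" "q > 1" "1 / p + 1 / q = 1" and q2: "q \<ge> 2"
    using p by (auto simp: q field_simps)
  have Fy: "power_sum q y \<le> 1" and Fu: "power_sum q u \<le> 1"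
    using polar_lp_ball[OF pq] y u by blast+
  have "power_sum q ((1/2) *\<^sub>R (y + u)) + power_sum q ((1/2) *\<^sub>R (y - u)) \<le> (\<Sum>i\<in>UNIV. (\<bar>y $ i\<bar> powr q + \<bar>u $ i\<bar> powr q) / 2)"
    unfolding power_sum_def sum.distrib[symmetric]
  proof (rule sum_mono)
    fix i
    show "\<bar>((1/2) *\<^sub>R (y + u)) $ i\<bar> powr q + \<bar>((1/2) *\<^sub>R (y - u)) $ i\<bar> powr q \<le> (\<bar>y $ i\<bar> powr q + \<bar>u $ i\<bar> powr q) / 2"
      using clarkson_scalar[OF q2, of "y $ i" "u $ i"] by simp
  qed
  also have "\<dots> = (power_sum q y + power_sum q u) / 2"
    by (simp add: power_sum_def sum.distrib[symmetric] sum_divide_distrib)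
  also have "\<dots> \<le> 1" using Fy Fu by simp
  finally have d: "power_sum q ((1/2) *\<^sub>R (y - u)) \<le> (\<phi> / 2) powr q"
    using power_sum_midpoint_ge[OF pq x xy xu] \<phi>(2) by linarith
  have "power_sum q ((1 / \<phi>) *\<^sub>R (y - u)) = power_sum q ((1/2) *\<^sub>R (y - u)) / (\<phi> / 2) powr q"
    unfolding power_sum_def sum_divide_distrib
  proof (rule sum.cong[OF refl])
    fix i
    have "\<bar>((1 / \<phi>) *\<^sub>R (y - u)) $ i\<bar> = \<bar>((1/2) *\<^sub>R (y - u)) $ i\<bar> / (\<phi> / 2)"
      using \<phi>(1) by (simp add: abs_mult)
    then show "\<bar>((1 / \<phi>) *\<^sub>R (y - u)) $ i\<bar> powr q = \<bar>((1/2) *\<^sub>R (y - u)) $ i\<bar> powr q / (\<phi> / 2) powr q"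
      using \<phi>(1) by (simp add: powr_divide)
  qed
  also have "\<dots> \<le> 1" using d \<phi>(1) by simp
  finally have D: "power_sum q ((1 / \<phi>) *\<^sub>R (y - u)) \<le> 1" .
  have "v \<bullet> (y - u) \<le> \<phi>" if v: "v \<in> lp_ball p" for v
  proof -
    have "v \<bullet> ((1 / \<phi>) *\<^sub>R (y - u)) \<le> power_sum p v / p + power_sum q ((1 / \<phi>) *\<^sub>R (y - u)) / q"
      by (rule inner_le_power_sums[OF pq])
    also have "\<dots> \<le> 1 / p + 1 / q" using v D pq by (intro add_mono divide_right_mono) (auto simp: lp_ball_iff)
    finally show ?thesis using pq(3) \<phi>(1) by simp
  qed
  from this[OF w] this[OF uminus_lp_ball[OF w]] show "\<bar>w \<bullet> (y - u)\<bar> \<le> \<phi>" by simp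
qed

section \<open>Linear stability and its consequences\<close>

text \<open>After the reduction to maximal position the core estimate applies to every \<open>e\<close> slightly larger than \<open>\<delta>\<close>: a
translate of \<open>(n - e) L\<close> covering the body would make the distance smaller than assumed.  The bound for \<open>\<delta>\<close> itself
follows by letting \<open>e\<close> decrease to \<open>\<delta>\<close>, which also covers \<open>\<delta> = 0\<close>.\<close>

theorem banach_mazur_stability:
  fixes K L S :: "(real^'n) set"
  defines "n \<equiv> real CARD('n)"
  assumes n2: "n \<ge> 2" and K: "convex_body K" and S: "regular_simplex S"
    and L: "compact L" "convex L" "0 \<in> interior L" "\<And>v. v \<in> L \<Longrightarrow> - v \<in> L"
    and sm: "smooth_with L \<beta> (1 / (50 * n\<^sup>2))" and \<beta>: "0 < \<beta>" "\<beta> \<le> 1"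
    and \<delta>: "0 \<le> \<delta>" "\<delta> < \<beta> / (416 * n ^ 3)"
    and far: "banach_mazur_dist K L \<ge> n - \<delta>"
  shows "banach_mazur_dist K S \<le> 1 + 156 * n ^ 3 * \<delta> / \<beta>"
proof -
  have K': "compact K" "convex K" "interior K \<noteq> {}" using K by (auto simp: convex_body_def)
  obtain M b where M: "det M > 0" "\<And>x. x \<in> L \<Longrightarrow> M *v x + b \<in> K"
    "\<And>N d. (\<forall>x\<in>L. N *v x + d \<in> K) \<Longrightarrow> det N \<le> det M"
    using maximal_affine_image[OF L(1,3) K'(1,3)] by blast
  have A: "linear ((*v) M)" "bij ((*v) M)"
  proof -
    have "invertible M" using M(1) by (simp add: invertible_det_nz)
    then show "bij ((*v) M)" by (simp add: invertible_eq_bij)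
  qed simp
  define K0 where "K0 = (\<lambda>x. M *v x + b) -` K"
  have KK0: "K = (\<lambda>x. M *v x + b) ` K0"
  proof -
    have "surj (\<lambda>x. M *v x + b)"
      using A(2) by (metis (mono_tags, lifting) bij_is_surj diff_add_cancel surj_def)
    then show ?thesis by (simp add: K0_def surj_image_vimage_eq)
  qed
  have dist_K0: "banach_mazur_dist K X = banach_mazur_dist K0 X" for X
    unfolding KK0 by (rule banach_mazur_dist_affine_image[OF A])
  have LK0: "L \<subseteq> K0" using M(2) by (auto simp: K0_def)
  have K0: "closed K0" "convex K0"
  proof -
    have "continuous_on UNIV (\<lambda>x. M *v x + b)"
      by (intro continuous_intros linear_continuous_on linear_conv_bounded_linear[THEN iffD1] A)
    then show "closed K0" unfolding K0_def using closed_vimage compact_imp_closed[OF K'(1)] by blast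
    have "K0 = (*v) M -` ((+) (- b) ` K)"
      by (force simp: K0_def image_iff algebra_simps)
    then show "convex K0" using K'(2) by (simp add: convex_linear_vimage[OF A(1)] convex_translation)
  qed
  have max: "det N \<le> 1" if "\<forall>x\<in>L. N *v x + d \<in> K0" for N d
  proof -
    have "\<forall>x\<in>L. (M ** N) *v x + (M *v d + b) \<in> K"
      using that by (simp add: K0_def matrix_vector_mul_assoc[symmetric] matrix_vector_right_distrib add.assoc)
    then have "det M * det N \<le> det M * 1" using M(3) by (fastforce simp: det_mul)
    then show ?thesis using M(1) by simp
  qed
  have "\<exists>(I :: ((real^'n^'n) \<times> (real^'n)) set) c x y. contact_decomposition K0 L I c x y n"
    unfolding n_def by (rule john_decomposition[OF L(1-3) _ K0 LK0]) (erule L(4), erule max)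
  then obtain I :: "((real^'n^'n) \<times> (real^'n)) set" and c x y where "contact_decomposition K0 L I c x y n"
    by blast
  then interpret contact_decomposition K0 L I c x y n .
  have bound: "banach_mazur_dist K S \<le> 1 + 156 * n ^ 3 * e / \<beta>" if e: "\<delta> < e" "e < \<beta> / (416 * n ^ 3)" for e
  proof -
    have "n ^ 3 \<ge> 8" using power_mono[OF n2, of 3] by simp
    then have "\<beta> \<le> 416 * n ^ 3" "416 * n ^ 3 > 0" using \<beta> by linarith+
    then have "\<beta> / (416 * n ^ 3) \<le> 1" by (simp only: divide_le_eq_1_pos)
    then have e1: "0 < e" "e < 1" using e \<delta> by linarith+
    have "\<not> K0 \<subseteq> (\<lambda>v. z' + (n - e) *\<^sub>R v) ` L" for z'
    proof
      assume "K0 \<subseteq> (\<lambda>v. z' + (n - e) *\<^sub>R v) ` L"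
      then have "banach_mazur_dist K0 L \<le> n - e"
        using banach_mazur_dist_sandwich[OF LK0] e1 n2 by simp
      then show False using far e dist_K0 by simp
    qed
    from dist_simplex_le_of_not_covered[OF n2 e1 this sm \<beta>(1) e(2) K0(2) S] show ?thesis using dist_K0 by simp
  qed
  have n3: "n ^ 3 > 0" using n2 by simp
  show ?thesis
  proof (rule ccontr)
    assume neg: "\<not> ?thesis"
    \<comment> \<open>the value of \<open>e\<close> at which the linear bound would equal the distance\<close>
    define e' where "e' = (banach_mazur_dist K S - 1) * \<beta> / (156 * n ^ 3)"
    have "\<delta> < e'" using neg \<beta> n3 by (simp add: e'_def field_simps)
    then obtain e where e: "\<delta> < e" "e < min e' (\<beta> / (416 * n ^ 3))"
      using dense[of \<delta> "min e' (\<beta> / (416 * n ^ 3))"] \<delta> by auto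
    then have "banach_mazur_dist K S \<le> 1 + 156 * n ^ 3 * e / \<beta>" by (intro bound) auto
    moreover have "156 * n ^ 3 * e / \<beta> < banach_mazur_dist K S - 1"
      using e \<beta> n3 by (simp add: e'_def field_simps)
    ultimately show False by simp
  qed
qed

text \<open>With \<open>a = (p - 1) n\<^sup>1\<^sup>4 \<epsilon>\<close> the linear bound exceeds \<open>1\<close> by at most \<open>48750 a\<close>, the asserted one by \<open>320 a powr (1/3)\<close>, and
\<open>a \<le> 2 powr (-19)\<close>.\<close>

lemma stability_lp_ball_ge_2:
  fixes K S :: "(real^'n) set" and p \<epsilon> :: real
  defines "n \<equiv> real CARD('n)"
  assumes n2: "n \<ge> 2" and K: "convex_body K" and S: "regular_simplex S"
    and p: "p \<ge> 2" and \<epsilon>: "0 \<le> \<epsilon>" "\<epsilon> \<le> 1 / (2 ^ 19 * (p - 1) * n ^ 14)"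
    and far: "banach_mazur_dist K (lp_ball p) \<ge> (1 - \<epsilon>) * n"
  shows "banach_mazur_dist K S \<le> 1 + (320 * (p - 1) powr (1 / 3) * n powr (14 / 3)) * \<epsilon> powr (1 / 3)"
proof -
  \<comment> \<open>chosen to make the smoothness estimate for the radius \<open>1 / (50 n\<^sup>2)\<close> an equality\<close>
  define \<beta> where "\<beta> = 1 / (10 ^ 4 * (p - 1) * n ^ 5)"
  define a where "a = (p - 1) * n ^ 14 * \<epsilon>"
  have n0: "n > 0" using n2 by simp
  have p1: "p - 1 \<ge> 1" using p by simp
  have a: "0 \<le> a" "a \<le> 1 / 2 ^ 19"
  proof -
    have X: "(p - 1) * n ^ 14 > 0" using p n0 by simp
    then show "0 \<le> a" using \<epsilon>(1) p1 by (simp add: a_def)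
    have "(2::real) ^ 19 * ((p - 1) * n ^ 14) > 0" by (intro mult_pos_pos[OF _ X]) simp
    then have "\<epsilon> * (2 ^ 19 * ((p - 1) * n ^ 14)) \<le> 1"
      using \<epsilon>(2) by (simp only: pos_le_divide_eq mult.assoc)
    then have "2 ^ 19 * a \<le> 1" by (simp only: a_def mult_ac)
    then show "a \<le> 1 / 2 ^ 19" by simp
  qed
  have n5: "n ^ 5 \<ge> 32" using power_mono[OF n2, of 5] by simp
  have \<beta>: "0 < \<beta>" using p1 n0 by (simp add: \<beta>_def)
  have \<beta>1: "\<beta> \<le> 1"
  proof -
    have "1 * 1 \<le> (p - 1) * n ^ 5" using p1 n5 by (intro mult_mono) auto
    then have "1 * 1 \<le> 10 ^ 4 * ((p - 1) * n ^ 5)" by (intro mult_mono) auto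
    then have "10 ^ 4 * (p - 1) * n ^ 5 \<ge> 1" by (simp only: mult.assoc mult_1)
    then show ?thesis unfolding \<beta>_def by (simp add: divide_le_eq_1)
  qed
  have sm: "smooth_with (lp_ball p :: (real^'n) set) \<beta> (1 / (50 * n\<^sup>2))"
  proof (rule smooth_lp_ball_ge_2[OF p])
    show "4 * real CARD('n) * (p - 1) * \<beta> \<le> (1 / (50 * n\<^sup>2))\<^sup>2"
      unfolding n_def[symmetric] \<beta>_def using n0 p1 by (simp add: field_simps eval_nat_numeral)
  qed simp
  have lin: "n * \<epsilon> / \<beta> * n ^ 3 = 10 ^ 4 * a / n ^ 5"
    using n0 p1 by (simp add: a_def \<beta>_def field_simps eval_nat_numeral)
  have small: "n * \<epsilon> < \<beta> / (416 * n ^ 3)"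
  proof -
    have "10 ^ 4 * a / n ^ 5 \<le> 10 ^ 4 * (1 / 2 ^ 19) / 32" using a n5 by (intro frac_le mult_left_mono) auto
    then have "n * \<epsilon> / \<beta> * n ^ 3 < 1 / 416" unfolding lin by simp
    then show ?thesis using \<beta> n0 by (simp add: field_simps)
  qed
  have "banach_mazur_dist K S \<le> 1 + 156 * n ^ 3 * (n * \<epsilon>) / \<beta>"
    unfolding n_def
    by (rule banach_mazur_stability[OF n2[unfolded n_def] K S compact_lp_ball convex_lp_ball zero_in_interior_lp_ball
        uminus_lp_ball sm[unfolded n_def] \<beta> \<beta>1 _ small[unfolded n_def]])
      (use p \<epsilon> n0 far in \<open>auto simp: n_def algebra_simps\<close>)
  also have "156 * n ^ 3 * (n * \<epsilon>) / \<beta> \<le> 320 * a powr (1 / 3)"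
  proof -
    define t where "t = a powr (1 / 3)"
    have t0: "t \<ge> 0" by (simp add: t_def)
    have t3: "t ^ 3 = a" using a(1) by (cases "a = 0") (simp_all add: t_def powr_power)
    have t6: "t \<le> 1 / 2 ^ 6"
    proof (rule power_le_imp_le_base)
      show "t ^ Suc 2 \<le> (1 / 2 ^ 6) ^ Suc 2" using t3 a by (simp add: eval_nat_numeral)
    qed simp
    have "156 * n ^ 3 * (n * \<epsilon>) / \<beta> = 156 * (10 ^ 4 * a / n ^ 5)" unfolding lin[symmetric] by simp
    also have "\<dots> \<le> 156 * (10 ^ 4 * a / 32)" using a n5 by (intro mult_left_mono frac_le) auto
    also have "\<dots> = 48750 * t * t * t" unfolding t3[symmetric] by (simp add: power3_eq_cube)
    also have "\<dots> \<le> 48750 * (1 / 2 ^ 6) * (1 / 2 ^ 6) * t" using t0 t6 by (intro mult_mono) auto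
    also have "\<dots> \<le> 320 * t" using t0 by simp
    finally show ?thesis by (simp add: t_def)
  qed
  also have "a powr (1 / 3) = (p - 1) powr (1 / 3) * n powr (14 / 3) * \<epsilon> powr (1 / 3)"
  proof -
    have "(n ^ 14) powr (1 / 3) = n powr (14 / 3)"
      using n0 by (simp add: powr_powr flip: powr_numeral)
    then show ?thesis using p1 n0 \<epsilon> by (simp add: a_def powr_mult)
  qed
  finally show ?thesis by (simp add: mult.assoc)
qed

text \<open>With \<open>a = \<epsilon> / \<epsilon>\<^sub>0 \<le> 1\<close> the linear bound exceeds \<open>1\<close> by at most \<open>a\<close>, and the asserted one by at least
\<open>2 a powr (1/(q+1))\<close>.\<close>

lemma stability_lp_ball_less_2:
  fixes K S :: "(real^'n) set" and p q \<epsilon> :: real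
  defines "n \<equiv> real CARD('n)"
  assumes n2: "n \<ge> 2" and K: "convex_body K" and S: "regular_simplex S"
    and p: "1 < p" "p < 2" and q: "q = p / (p - 1)"
    and \<epsilon>: "0 \<le> \<epsilon>" "\<epsilon> \<le> 1 / (80 powr (q + 1) * q * n powr (5 * q + 4))"
    and far: "banach_mazur_dist K (lp_ball p) \<ge> (1 - \<epsilon>) * n"
  shows "banach_mazur_dist K S \<le> 1 + (160 * n powr (q / (q + 1) + 4) * (q * (q - 1) powr (q - 1)) powr (1 / (q + 1))) * \<epsilon> powr (1 / (q + 1))"
proof -
  define \<beta> where "\<beta> = 2 / q * (1 / (100 * n\<^sup>2)) powr q"
  define a where "a = 80 powr (q + 1) * q * n powr (5 * q + 4) * \<epsilon>"
  have n0: "n > 0" using n2 by simp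
  have q2: "q > 2" using p by (simp add: q less_divide_eq)
  have q0: "q > 0" using q2 by simp
  have a: "0 \<le> a" "a \<le> 1" using \<epsilon> q0 n0 by (simp_all add: a_def field_simps)
  have \<beta>: "0 < \<beta>" using q0 n0 by (simp add: \<beta>_def)
  have \<beta>1: "\<beta> \<le> 1"
  proof -
    have "n\<^sup>2 \<ge> 4" using power_mono[OF n2, of 2] by simp
    then have "100 * n\<^sup>2 \<ge> 1" by linarith
    then have "1 / (100 * n\<^sup>2) \<le> 1" by (rule divide_le_eq_1_pos[THEN iffD2, rotated]) (use n0 in simp)
    then have "(1 / (100 * n\<^sup>2)) powr q \<le> 1 powr q" using q0 by (intro powr_mono2) auto
    then have "2 / q * (1 / (100 * n\<^sup>2)) powr q \<le> 1 * 1" using q2 by (intro mult_mono) auto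
    then show ?thesis by (simp add: \<beta>_def)
  qed
  have sm: "smooth_with (lp_ball p :: (real^'n) set) \<beta> (1 / (50 * n\<^sup>2))"
    by (rule smooth_lp_ball_le_2[OF p(1) _ q]) (use p n0 q0 in \<open>auto simp: \<beta>_def\<close>)
  have lin: "156 * n ^ 3 * (n * \<epsilon>) / \<beta> = 78 / 80 * ((5 / 4) / n ^ 3) powr q * a"
  proof -
    have inv: "1 / \<beta> = q / 2 * (100 * n\<^sup>2) powr q"
      using q0 n0 by (simp add: \<beta>_def powr_divide)
    have A: "a = 80 * q * n ^ 4 * ((80 * n ^ 5) powr q * \<epsilon>)"
    proof -
      have "80 powr (q + 1) = 80 * 80 powr q" by (simp add: powr_add)
      moreover have "n powr (5 * q + 4) = n ^ 4 * (n ^ 5) powr q"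
        using n0 by (simp add: powr_add powr_powr flip: powr_numeral)
      ultimately show ?thesis using n0 by (simp add: a_def powr_mult)
    qed
    have "((5 / 4) / n ^ 3) powr q * (80 * n ^ 5) powr q = (100 * n\<^sup>2) powr q"
    proof -
      have "((5 / 4) / n ^ 3) * (80 * n ^ 5) = 100 * n\<^sup>2" using n0 by (simp add: eval_nat_numeral)
      then show ?thesis using n0 by (metis powr_mult)
    qed
    then have "78 / 80 * ((5 / 4) / n ^ 3) powr q * a = 78 * q * n ^ 4 * (100 * n\<^sup>2) powr q * \<epsilon>"
      unfolding A by (simp add: mult_ac)
    also have "\<dots> = 156 * n ^ 3 * (n * \<epsilon>) * (1 / \<beta>)"
      unfolding inv by (simp add: eval_nat_numeral)
    finally show ?thesis by simp
  qed
  have fac: "((5 / 4) / n ^ 3) powr q \<le> 1 / 16"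
  proof -
    have "n ^ 3 \<ge> 2 ^ 3" using n2 by (intro power_mono) auto
    then have "(5 / 4) / n ^ 3 \<le> 1 / 4" using n0 by (simp add: divide_le_eq)
    then have "((5 / 4) / n ^ 3) powr q \<le> (1 / 4) powr q" using q0 n0 by (intro powr_mono2) auto
    also have "\<dots> \<le> (1 / 4) powr 2" using q2 by (intro powr_mono') auto
    also have "\<dots> = 1 / 16" by (simp add: powr_numeral power2_eq_square)
    finally show ?thesis .
  qed
  have lin_le: "156 * n ^ 3 * (n * \<epsilon>) / \<beta> \<le> 78 / 80 * (1 / 16) * a"
    unfolding lin using fac a by (intro mult_right_mono mult_left_mono) auto
  have small: "n * \<epsilon> < \<beta> / (416 * n ^ 3)"
  proof -
    have "156 * n ^ 3 * (n * \<epsilon>) / \<beta> < 156 / 416" using lin_le a by simp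
    then show ?thesis using \<beta> n0 by (simp add: field_simps)
  qed
  have "banach_mazur_dist K S \<le> 1 + 156 * n ^ 3 * (n * \<epsilon>) / \<beta>"
    unfolding n_def
    by (rule banach_mazur_stability[OF n2[unfolded n_def] K S compact_lp_ball convex_lp_ball zero_in_interior_lp_ball
        uminus_lp_ball sm[unfolded n_def] \<beta> \<beta>1 _ small[unfolded n_def]])
      (use p \<epsilon> n0 far in \<open>auto simp: n_def algebra_simps\<close>)
  also have "156 * n ^ 3 * (n * \<epsilon>) / \<beta> \<le> 2 * a powr (1 / (q + 1))"
  proof -
    have "a \<le> a powr (1 / (q + 1))"
      using powr_mono'[of "1 / (q + 1)" 1 a] a q0 by simp
    then show ?thesis using lin_le a(1) by linarith
  qed
  also have "2 * a powr (1 / (q + 1)) = 160 * n powr (q / (q + 1) + 4) * q powr (1 / (q + 1)) * \<epsilon> powr (1 / (q + 1))"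
  proof -
    have "(80 powr (q + 1)) powr (1 / (q + 1)) = 80" using q0 by (simp add: powr_powr)
    moreover have "(n powr (5 * q + 4)) powr (1 / (q + 1)) = n powr (q / (q + 1) + 4)"
    proof -
      have "(5 * q + 4) * (1 / (q + 1)) = q / (q + 1) + 4" using q0 by (simp add: field_simps)
      then show ?thesis by (simp only: powr_powr)
    qed
    ultimately show ?thesis using q0 \<epsilon>(1) by (simp add: a_def powr_mult)
  qed
  also have "\<dots> \<le> 160 * n powr (q / (q + 1) + 4) * (q * (q - 1) powr (q - 1)) powr (1 / (q + 1)) * \<epsilon> powr (1 / (q + 1))"
  proof -
    have "q * 1 \<le> q * (q - 1) powr (q - 1)" using q2 by (intro mult_left_mono ge_one_powr_ge_zero) auto
    then have "q powr (1 / (q + 1)) \<le> (q * (q - 1) powr (q - 1)) powr (1 / (q + 1))" using q0 by (intro powr_mono2) auto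
    then show ?thesis by (intro mult_left_mono mult_right_mono) auto
  qed
  finally show ?thesis by simp
qed

theorem corollary5:
  fixes K S :: "(real ^ 'n) set" and n :: nat
  assumes "CARD('n) = n" and "n \<ge> 2" and "convex_body K" and "regular_simplex S"
  shows
    "(\<forall>p \<epsilon> :: real.
        2 \<le> p \<and> 0 \<le> \<epsilon> \<and> \<epsilon> \<le> 1 / (2 ^ 19 * (p - 1) * real n ^ 14) \<and>
        banach_mazur_dist K (lp_ball p) \<ge> (1 - \<epsilon>) * real n \<longrightarrow>
        banach_mazur_dist K S \<le>
          1 + (320 * (p - 1) powr (1 / 3) * real n powr (14 / 3)) * \<epsilon> powr (1 / 3)) \<and>
     (\<forall>p q \<epsilon> :: real.
        1 < p \<and> p < 2 \<and> q = p / (p - 1) \<and>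
        0 \<le> \<epsilon> \<and> \<epsilon> \<le> 1 / (80 powr (q + 1) * q * real n powr (5 * q + 4)) \<and>
        banach_mazur_dist K (lp_ball p) > (1 - \<epsilon>) * real n \<longrightarrow>
        banach_mazur_dist K S \<le>
          1 + (160 * real n powr (q / (q + 1) + 4) * (q * (q - 1) powr (q - 1)) powr (1 / (q + 1)))
                * \<epsilon> powr (1 / (q + 1)))"
proof -
  have n2: "real CARD('n) \<ge> 2" using assms(1,2) by simp
  show ?thesis
    using stability_lp_ball_ge_2[OF n2 assms(3,4)] stability_lp_ball_less_2[OF n2 assms(3,4)]
    unfolding assms(1) by (auto intro: less_imp_le)
qed

end
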